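(* The following problem is undecidable: given $d\ge1$ and finitely many matrices $M_1,\dots,M_k\in\mathbb{Q}^{d\times d}$, decide whether the semigroup generated by $M_1,\dots,M_k$ under matrix multiplication (the set of all products $M_{i_1}\cdots M_{i_s}$ with $s\ge1$) contains a matrix all of whose entries are non-negative. *)

theory Defs
  imports "Jordan_Normal_Form.Matrix" "HOL-Library.Nat_Bijection"
begin

datatype recf =
    Zero
  | Succ
  | Proj nat
  | Comp recf "recf list"
  | Prec recf recf
  | Minim recf

inductive eval :: "recf \<Rightarrow> nat list \<Rightarrow> nat \<Rightarrow> bool" where
  eval_Zero: "eval Zero xs 0"
| eval_Succ: "eval Succ (x # xs) (Suc x)"
| eval_Proj: "i < length xs \<Longrightarrow> eval (Proj i) xs (xs ! i)"
| eval_Comp: "length ys = length gs \<Longrightarrow> (\<forall>i < length gs. eval (gs ! i) xs (ys ! i))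
               \<Longrightarrow> eval f ys r \<Longrightarrow> eval (Comp f gs) xs r"
| eval_Prec0: "eval f xs r \<Longrightarrow> eval (Prec f g) (0 # xs) r"
| eval_PrecS: "eval (Prec f g) (y # xs) r0 \<Longrightarrow> eval g (y # r0 # xs) r
               \<Longrightarrow> eval (Prec f g) (Suc y # xs) r"
| eval_Minim: "eval f (r # xs) 0 \<Longrightarrow> (\<forall>y < r. \<exists>v. eval f (y # xs) v \<and> v > 0)
               \<Longrightarrow> eval (Minim f) xs r"

definition decidable_problem :: "('a \<Rightarrow> nat) \<Rightarrow> ('a \<Rightarrow> bool) \<Rightarrow> ('a \<Rightarrow> bool) \<Rightarrow> bool" where
  "decidable_problem code admissible P \<longleftrightarrow>
     (\<exists>f. \<forall>x. admissible x \<longrightarrow> eval f [code x] (if P x then 1 else 0))"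

definition encode_rat :: "rat \<Rightarrow> nat" where
  "encode_rat q = prod_encode (int_encode (fst (quotient_of q)), int_encode (snd (quotient_of q)))"

definition encode_mat :: "rat mat \<Rightarrow> nat" where
  "encode_mat A = prod_encode (dim_row A, prod_encode (dim_col A,
      list_encode (map (\<lambda>row. list_encode (map encode_rat row)) (mat_to_list A))))"

text \<open>An instance is a dimension d together with the list of generators M_1, ..., M_k.\<close>
definition encode_instance :: "nat \<times> rat mat list \<Rightarrow> nat" where
  "encode_instance inst = prod_encode (fst inst, list_encode (map encode_mat (snd inst)))"

definition admissible_instance :: "nat \<times> rat mat list \<Rightarrow> bool" where
  "admissible_instance inst \<longleftrightarrow> fst inst \<ge> 1 \<and> (\<forall>M \<in> set (snd inst). M \<in> carrier_mat (fst inst) (fst inst))"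

inductive_set gen_semigroup :: "'a::semiring_1 mat list \<Rightarrow> 'a mat set" for Ms where
  gen: "M \<in> set Ms \<Longrightarrow> M \<in> gen_semigroup Ms"
| mult: "A \<in> gen_semigroup Ms \<Longrightarrow> M \<in> set Ms \<Longrightarrow> A * M \<in> gen_semigroup Ms"

definition nonneg_mat :: "'a::{zero,ord} mat \<Rightarrow> bool" where
  "nonneg_mat A \<longleftrightarrow> (\<forall>i < dim_row A. \<forall>j < dim_col A. A $$ (i, j) \<ge> 0)"

definition semigroup_has_nonneg :: "nat \<times> rat mat list \<Rightarrow> bool" where
  "semigroup_has_nonneg inst \<longleftrightarrow> (\<exists>A \<in> gen_semigroup (snd inst). nonneg_mat A)"

end

(* A recursive function is simulated by a nondeterministic program on rational registers whose only
   tests are "register = 0". A row vector carrying the constant 1, the registers and their squares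
   is transformed linearly by assignments, and every failed test adds a negative square to an
   accumulator entry. A first letter loads the input, a last letter tests for the final label and
   clears the registers, and two further entries are negative unless the product starts and ends
   with these letters. So a product is nonnegative iff it contains a faithful accepting run.

   Neither a universal machine nor computability of the simulation is needed: the input only occurs
   in the first row of one matrix, so the instance code is a recursive function of the input and of
   the codes of the constant parts. Given a decider, let g apply it to the instance assembled from
   codes of parts, with these same codes as input. The instance simulating "g returns 0", run on the
   codes of its own parts, is then positive iff the decider rejects it. *)
theory Submission
  imports Defs
begin

section \<open>Determinism of evaluation, and arithmetic for computing instance codes\<close>

section \<open>Recursive functions\<close>

text \<open>The final contradiction rests on this: a decider cannot answer both 0 and 1. For
  \<open>Minim\<close>, the smaller of two candidates would have value 0 as a result and a positive
  value as a predecessor of the other.\<close>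

lemma eval_deterministic: "eval f xs a \<Longrightarrow> eval f xs b \<Longrightarrow> a = b"
proof (induction arbitrary: b rule: eval.induct)
  case (eval_Comp ys gs xs f r)
  from eval_Comp.prems obtain zs where zs: "length zs = length gs"
    "\<forall>i<length gs. eval (gs ! i) xs (zs ! i)" "eval f zs b"
    by (cases rule: eval.cases) auto
  have "ys = zs"
    using zs eval_Comp.hyps(1) eval_Comp.IH(1) by (intro nth_equalityI) auto
  then show ?case using zs(3) eval_Comp.IH(2) by blast
next
  case (eval_Prec0 f xs r g)
  from eval_Prec0.prems show ?case
    by (cases rule: eval.cases) (use eval_Prec0.IH in auto)
next
  case (eval_PrecS f g y xs r0 r)
  from eval_PrecS.prems show ?case
    by (cases rule: eval.cases) (use eval_PrecS.IH in auto)
next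
  case (eval_Minim f r xs)
  from eval_Minim.prems have b: "eval f (b # xs) 0" "\<forall>y<b. \<exists>v. eval f (y # xs) v \<and> v > 0"
    by (cases rule: eval.cases; simp)+
  show ?case
  proof (rule linorder_cases[of r b])
    assume "r < b"
    then obtain v where "eval f (r # xs) v" "v > 0" using b(2) by blast
    then show ?thesis using eval_Minim.IH(1)[of v] by simp
  next
    assume "b < r"
    then obtain v where "v > 0" "\<forall>x. eval f (b # xs) x \<longrightarrow> v = x" using eval_Minim.IH(2) by blast
    then show ?thesis using b(1) by auto
  qed
qed (auto elim: eval.cases)

lemma eval_Comp1: "eval g xs y \<Longrightarrow> eval f [y] r \<Longrightarrow> eval (Comp f [g]) xs r"
  by (rule eval_Comp[of "[y]"]) auto

lemma eval_Comp2:
  "eval g xs y \<Longrightarrow> eval h xs z \<Longrightarrow> eval f [y, z] r \<Longrightarrow> eval (Comp f [g, h]) xs r"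
  by (rule eval_Comp[of "[y, z]"]) (auto simp: less_Suc_eq)

lemma eval_Proj': "i < length xs \<Longrightarrow> xs ! i = v \<Longrightarrow> eval (Proj i) xs v"
  using eval_Proj by blast

fun rf_const :: "nat \<Rightarrow> recf" where
  "rf_const 0 = Zero"
| "rf_const (Suc n) = Comp Succ [rf_const n]"

lemma eval_const: "eval (rf_const n) xs n"
  by (induction n) (auto intro: eval_Zero eval_Succ eval_Comp1)

definition rf_add :: recf where
  "rf_add = Prec (Proj 0) (Comp Succ [Proj 1])"

lemma eval_add: "eval rf_add [x, y] (x + y)"
  unfolding rf_add_def
proof (induction x)
  case (Suc x)
  have "eval (Comp Succ [Proj 1]) [x, x + y, y] (Suc (x + y))"
    by (intro eval_Comp1[OF eval_Proj' eval_Succ]) auto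
  then show ?case using eval_PrecS[OF Suc] by simp
qed (auto intro!: eval_Prec0 eval_Proj')

definition rf_mult :: recf where
  "rf_mult = Prec Zero (Comp rf_add [Proj 1, Proj 2])"

lemma eval_mult: "eval rf_mult [x, y] (x * y)"
  unfolding rf_mult_def
proof (induction x)
  case (Suc x)
  have "eval (Comp rf_add [Proj 1, Proj 2]) [x, x * y, y] (x * y + y)"
    by (intro eval_Comp2[OF eval_Proj' eval_Proj' eval_add]) auto
  then show ?case using eval_PrecS[OF Suc] by (simp add: add.commute)
qed (auto intro: eval_Prec0 eval_Zero)

definition rf_triangle :: recf where
  "rf_triangle = Prec Zero (Comp rf_add [Proj 1, Comp Succ [Proj 0]])"

lemma eval_triangle: "eval rf_triangle [n] (triangle n)"
  unfolding rf_triangle_def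
proof (induction n)
  case (Suc n)
  have "eval (Comp rf_add [Proj 1, Comp Succ [Proj 0]]) [n, triangle n] (triangle n + Suc n)"
    by (intro eval_Comp2[OF eval_Proj' eval_Comp1[OF eval_Proj' eval_Succ] eval_add]) auto
  then show ?case using eval_PrecS[OF Suc] by simp
qed (auto intro: eval_Prec0 eval_Zero)

text \<open>Cantor's pairing \<open>triangle (a + b) + a\<close>, the one behind
  \<open>prod_encode\<close>.\<close>

definition rf_pair :: "recf \<Rightarrow> recf \<Rightarrow> recf" where
  "rf_pair g h = Comp rf_add [Comp rf_triangle [Comp rf_add [g, h]], g]"

lemma eval_pair: "eval g xs a \<Longrightarrow> eval h xs b \<Longrightarrow> eval (rf_pair g h) xs (prod_encode (a, b))"
  unfolding rf_pair_def prod_encode_def prod.case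
  by (intro eval_Comp2[OF eval_Comp1[OF eval_Comp2[OF _ _ eval_add] eval_triangle] _ eval_add])

text \<open>\<open>list_encode\<close> codes a nonempty list as the successor of the pair of its
  head and its coded tail.\<close>

definition rf_cons :: "recf \<Rightarrow> recf \<Rightarrow> recf" where
  "rf_cons g h = Comp Succ [rf_pair g h]"

lemma eval_cons:
  "eval g xs a \<Longrightarrow> eval h xs (list_encode as) \<Longrightarrow> eval (rf_cons g h) xs (list_encode (a # as))"
  unfolding rf_cons_def by (auto intro: eval_Comp1 eval_pair eval_Succ)

text \<open>\<open>int_encode\<close> doubles nonnegative integers, so the denominator 1 contributes
  the constant 2.\<close>

lemma encode_rat_of_nat: "encode_rat (of_nat n) = prod_encode (2 * n, 2)"
proof -
  have "quotient_of (of_nat n) = (int n, 1)"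
    using quotient_of_int[of "int n"] by simp
  then show ?thesis
    by (simp add: encode_rat_def int_encode_def sum_encode_def)
qed

definition rf_rat :: "recf \<Rightarrow> recf" where
  "rf_rat g = rf_pair (Comp rf_mult [rf_const 2, g]) (rf_const 2)"

lemma eval_rat: "eval g xs n \<Longrightarrow> eval (rf_rat g) xs (encode_rat (of_nat n))"
  unfolding rf_rat_def encode_rat_of_nat
  by (intro eval_pair eval_Comp2[OF eval_const _ eval_mult] eval_const)

section \<open>Relational semantics of programs on rational registers\<close>

section \<open>Nondeterministic programs over a rational store\<close>

type_synonym store = "nat \<Rightarrow> rat"

text \<open>An assignment reads a single register: the square of \<open>a * s j + c\<close> is then
  linear in 1, \<open>s j\<close> and the square of \<open>s j\<close>, and no products of distinct
  registers have to be carried along.\<close>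

datatype cmd = Asg nat rat nat rat | Tst nat

fun cmd_sem :: "cmd \<Rightarrow> (store \<times> store) set" where
  "cmd_sem (Asg i a j c) = {(s, s'). s' = s(i := a * s j + c)}"
| "cmd_sem (Tst i) = {(s, s'). s' = s \<and> s i = 0}"

datatype prog = Cmd cmd | Seq prog prog | Star prog

fun sem :: "prog \<Rightarrow> (store \<times> store) set" where
  "sem (Cmd c) = cmd_sem c"
| "sem (Seq p q) = sem p O sem q"
| "sem (Star p) = (sem p)\<^sup>*"

lemma relcomp_function_iff [simp]: "(s, s') \<in> {(s, s'). s' = f s} O R \<longleftrightarrow> (f s, s') \<in> R"
  by auto

lemma relcomp_guard_iff [simp]: "(s, s') \<in> {(s, s'). s' = s \<and> P s} O R \<longleftrightarrow> P s \<and> (s, s') \<in> R"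
  by auto

definition skip :: cmd where "skip = Asg 0 1 0 0"

lemma cmd_sem_skip [simp]: "cmd_sem skip = Id"
  by (auto simp: skip_def)

text \<open>Stands for functions that are undefined because they receive too few arguments.\<close>

definition stuck :: prog where "stuck = Seq (Cmd (Asg 0 0 0 1)) (Cmd (Tst 0))"

lemma sem_stuck [simp]: "sem stuck = {}"
  by (auto simp: stuck_def)

definition changes_only :: "nat \<Rightarrow> nat \<Rightarrow> store \<Rightarrow> store \<Rightarrow> bool" where
  "changes_only n r s s' \<longleftrightarrow> (\<forall>i<n. i \<noteq> r \<longrightarrow> s' i = s i)"

text \<open>Registers from \<open>n\<close> upwards are scratch space.\<close>

definition computes :: "prog \<Rightarrow> recf \<Rightarrow> nat list \<Rightarrow> nat \<Rightarrow> nat \<Rightarrow> bool" where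
  "computes p f as r n \<longleftrightarrow> (\<forall>s xs. map s as = map of_nat xs \<longrightarrow>
     (\<forall>s'. (s, s') \<in> sem p \<longrightarrow> (\<exists>v. eval f xs v \<and> s' r = of_nat v \<and> changes_only n r s s')) \<and>
     (\<forall>v. eval f xs v \<longrightarrow> (\<exists>s'. (s, s') \<in> sem p \<and> s' r = of_nat v \<and> changes_only n r s s')))"

lemma computesI:
  assumes "\<And>s xs s'. map s as = map of_nat xs \<Longrightarrow> (s, s') \<in> sem p \<Longrightarrow>
      \<exists>v. eval f xs v \<and> s' r = of_nat v \<and> changes_only n r s s'"
    and "\<And>s xs v. map s as = map of_nat xs \<Longrightarrow> eval f xs v \<Longrightarrow>
      \<exists>s'. (s, s') \<in> sem p \<and> s' r = of_nat v \<and> changes_only n r s s'"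
  shows "computes p f as r n"
  using assms unfolding computes_def by blast

lemma computes_sound:
  assumes "computes p f as r n" "map s as = map of_nat xs" "(s, s') \<in> sem p"
  obtains v where "eval f xs v" "s' r = of_nat v" "\<And>i. i < n \<Longrightarrow> i \<noteq> r \<Longrightarrow> s' i = s i"
  using assms unfolding computes_def changes_only_def by blast

lemma computes_complete:
  assumes "computes p f as r n" "map s as = map of_nat xs" "eval f xs v"
  obtains s' where "(s, s') \<in> sem p" "s' r = of_nat v" "\<And>i. i < n \<Longrightarrow> i \<noteq> r \<Longrightarrow> s' i = s i"
  using assms unfolding computes_def changes_only_def by blast

section \<open>Programs for recursion, minimisation and composition\<close>

lemma map_store_cong:
  fixes s s' :: store
  assumes "map s as = map of_nat xs" "\<And>i. i \<in> set as \<Longrightarrow> s' i = s i"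
  shows "map s' as = map of_nat xs"
  using assms by (metis map_cong)

text \<open>Register \<open>n\<close> holds the current value, \<open>n + 1\<close> the counter,
  \<open>n + 2\<close> the number of rounds still due and \<open>n + 3\<close> the output of the
  step program. The loop may be left after any number of rounds, but only the right number passes
  the zero test on \<open>n + 2\<close>.\<close>

lemma computes_Prec:
  assumes f: "computes p f as n (n + 4)"
    and g: "computes q g ((n + 1) # n # as) (n + 3) (n + 4)"
    and as: "set (a # as) \<subseteq> {..<n}" and r: "r < n"
  shows "\<exists>p. computes p (Prec f g) (a # as) r n"
proof -
  let ?init = "Seq p (Seq (Cmd (Asg (n + 1) 0 0 0)) (Cmd (Asg (n + 2) 1 a 0)))"
  let ?body = "Seq q (Seq (Cmd (Asg n 1 (n + 3) 0))
    (Seq (Cmd (Asg (n + 1) 1 (n + 1) 1)) (Cmd (Asg (n + 2) 1 (n + 2) (- 1)))))"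
  let ?P = "Seq ?init (Seq (Star ?body) (Seq (Cmd (Tst (n + 2))) (Cmd (Asg r 1 n 0))))"
  \<comment> \<open>The rounds still due are a rational difference, so the invariant survives even
    in runs with more than \<open>x\<close> rounds.\<close>
  let ?inv = "\<lambda>(s::store) x k u (t::store). t n = of_nat u \<and> t (n + 1) = of_nat k \<and>
      t (n + 2) = of_nat x - of_nat k \<and> (\<forall>i<n. t i = s i)"
  have body_sound: "\<exists>u'. eval g (k # u # xs) u' \<and> ?inv s x (Suc k) u' t'"
    if "map s as = map of_nat xs" "?inv s x k u t" "(t, t') \<in> sem ?body" for s x xs k u t t'
  proof -
    from that(3) obtain t1 where t1: "(t, t1) \<in> sem q" and t': "t' = t1(n := t1 (n + 3),
      n + 1 := t1 (n + 1) + 1, n + 2 := t1 (n + 2) - 1)"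
      by auto
    have "map t as = map of_nat xs"
      using that(2) as by (intro map_store_cong[OF that(1)]) auto
    then have "map t ((n + 1) # n # as) = map of_nat (k # u # xs)"
      using that(2) by simp
    from computes_sound[OF g this t1] obtain v where "eval g (k # u # xs) v" "t1 (n + 3) = of_nat v"
      "\<And>i. i < n + 4 \<Longrightarrow> i \<noteq> n + 3 \<Longrightarrow> t1 i = t i" by metis
    then show ?thesis using that(2) unfolding t' by (intro exI[of _ v]) auto
  qed
  have body_complete: "\<exists>t'. (t, t') \<in> sem ?body \<and> ?inv s x (Suc k) u' t'"
    if "map s as = map of_nat xs" "?inv s x k u t" "eval g (k # u # xs) u'" for s x xs k u t u'
  proof -
    have "map t as = map of_nat xs"
      using that(2) as by (intro map_store_cong[OF that(1)]) auto
    then have "map t ((n + 1) # n # as) = map of_nat (k # u # xs)"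
      using that(2) by simp
    from computes_complete[OF g this that(3)] obtain t1 where t1: "(t, t1) \<in> sem q"
      "t1 (n + 3) = of_nat u'" "\<And>i. i < n + 4 \<Longrightarrow> i \<noteq> n + 3 \<Longrightarrow> t1 i = t i" by metis
    then show ?thesis using that(2)
      by (intro exI[of _ "t1(n := t1 (n + 3), n + 1 := t1 (n + 1) + 1, n + 2 := t1 (n + 2) - 1)"])
        (auto intro!: relcompI[OF t1(1)])
  qed
  have loop_sound: "\<exists>k u. eval (Prec f g) (k # xs) u \<and> ?inv s x k u t"
    if xs: "map s as = map of_nat xs" and t: "(t0, t) \<in> (sem ?body)\<^sup>*"
      and t0: "\<exists>u. eval f xs u \<and> ?inv s x 0 u t0" for s x xs t0 t
    using t
  proof (induction rule: rtrancl_induct)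
    case base
    from t0 obtain u where "eval f xs u" "?inv s x 0 u t0" by blast
    then show ?case by (intro exI[of _ 0] exI[of _ u]) (auto intro: eval_Prec0)
  next
    case (step t t')
    from step.IH obtain k u where ku: "eval (Prec f g) (k # xs) u" "?inv s x k u t" by blast
    from body_sound[OF xs ku(2) step.hyps(2)] obtain u'
      where u': "eval g (k # u # xs) u'" "?inv s x (Suc k) u' t'" by blast
    then show ?case using eval_PrecS[OF ku(1) u'(1)] by blast
  qed
  have init: "?inv s x 0 u (t(n + 1 := 0, n + 2 := t a))"
    if "map s (a # as) = map of_nat (x # xs)" "t n = of_nat u"
      "\<And>i. i < n + 4 \<Longrightarrow> i \<noteq> n \<Longrightarrow> t i = s i" for s t :: store and x xs u
    using that as by auto
  have loop_complete: "\<exists>t. (s, t) \<in> sem ?init O (sem ?body)\<^sup>* \<and> ?inv s x k u t"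
    if xs: "map s (a # as) = map of_nat (x # xs)" and "eval (Prec f g) (k # xs) u" for s :: store and x xs k u
    using that(2)
  proof (induction k arbitrary: u)
    case 0
    then have f0: "eval f xs u" by (cases rule: eval.cases) auto
    have "map s as = map of_nat xs" using xs by simp
    from computes_complete[OF f this f0] obtain t where t: "(s, t) \<in> sem p" "t n = of_nat u"
      "\<And>i. i < n + 4 \<Longrightarrow> i \<noteq> n \<Longrightarrow> t i = s i" by metis
    have "(s, t(n + 1 := 0, n + 2 := t a)) \<in> sem ?init"
      using as by (auto intro!: relcompI[OF t(1)])
    then show ?case using init[OF xs t(2,3)] by blast
  next
    case (Suc k)
    from Suc.prems obtain u0 where u0: "eval (Prec f g) (k # xs) u0" "eval g (k # u0 # xs) u"
      by (cases rule: eval.cases) auto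
    from Suc.IH[OF u0(1)] obtain t where t: "(s, t) \<in> sem ?init O (sem ?body)\<^sup>*" "?inv s x k u0 t"
      by blast
    have "map s as = map of_nat xs" using xs by simp
    from body_complete[OF this t(2) u0(2)] obtain t'
      where "(t, t') \<in> sem ?body" "?inv s x (Suc k) u t'" by blast
    then show ?case using t(1) by (meson relcomp.cases relcompI rtrancl.rtrancl_into_rtrancl)
  qed
  show ?thesis
  proof (intro exI[of _ ?P] computesI)
    fix s s' :: store and ys :: "nat list"
    assume ys: "map s (a # as) = map of_nat ys" and s': "(s, s') \<in> sem ?P"
    obtain x xs where ys_eq: "ys = x # xs" using ys by (cases ys) auto
    from s' obtain t0 t where t0: "(s, t0) \<in> sem ?init" and t: "(t0, t) \<in> (sem ?body)\<^sup>*"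
      and end_: "t (n + 2) = 0" "s' = t(r := t n)" by auto
    from t0 obtain t1 where t1: "(s, t1) \<in> sem p" and t0_eq: "t0 = t1(n + 1 := 0, n + 2 := t1 a)"
      using as by auto
    have xs: "map s as = map of_nat xs" using ys ys_eq by simp
    from computes_sound[OF f xs t1] obtain u where u: "eval f xs u" "t1 n = of_nat u"
      "\<And>i. i < n + 4 \<Longrightarrow> i \<noteq> n \<Longrightarrow> t1 i = s i" by metis
    have "?inv s x 0 u t0"
      using init[OF ys[unfolded ys_eq] u(2,3)] t0_eq by simp
    with loop_sound[OF xs t] u(1) obtain k v where kv: "eval (Prec f g) (k # xs) v" "?inv s x k v t"
      by blast
    then have "k = x" using end_(1) by auto
    then show "\<exists>v. eval (Prec f g) ys v \<and> s' r = of_nat v \<and> changes_only n r s s'"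
      using kv end_(2) ys_eq by (auto simp: changes_only_def)
  next
    fix s :: store and v and ys :: "nat list"
    assume ys: "map s (a # as) = map of_nat ys" and ev: "eval (Prec f g) ys v"
    obtain x xs where ys_eq: "ys = x # xs" using ys by (cases ys) auto
    from loop_complete[OF ys[unfolded ys_eq] ev[unfolded ys_eq]] obtain t
      where t: "(s, t) \<in> sem ?init O (sem ?body)\<^sup>*" "?inv s x x v t" by blast
    have "(t, t(r := t n)) \<in> sem (Seq (Cmd (Tst (n + 2))) (Cmd (Asg r 1 n 0)))"
      using t(2) by simp
    then have "(s, t(r := t n)) \<in> sem ?P"
      using t(1) unfolding sem.simps(2,3) by (meson relcomp.cases relcompI)
    then show "\<exists>s'. (s, s') \<in> sem ?P \<and> s' r = of_nat v \<and> changes_only n r s s'"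
      using t(2) by (intro exI[of _ "t(r := t n)"]) (auto simp: changes_only_def)
  qed
qed

lemma sem_Star_decr: "(s, s') \<in> sem (Star (Cmd (Asg i 1 i (- 1)))) \<longleftrightarrow> (\<exists>m::nat. s' = s(i := s i - of_nat m))"
proof
  assume "(s, s') \<in> sem (Star (Cmd (Asg i 1 i (- 1))))"
  then have "(s, s') \<in> (sem (Cmd (Asg i 1 i (- 1))))\<^sup>*" by simp
  then show "\<exists>m::nat. s' = s(i := s i - of_nat m)"
  proof (induction rule: rtrancl_induct)
    case base
    show ?case by (intro exI[of _ 0]) auto
  next
    case (step t t')
    then obtain m :: nat where "t = s(i := s i - of_nat m)" by blast
    then show ?case using step.hyps by (intro exI[of _ "Suc m"]) (auto simp: fun_eq_iff)
  qed
next
  assume "\<exists>m::nat. s' = s(i := s i - of_nat m)"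
  then obtain m :: nat where "s' = s(i := s i - of_nat m)" by blast
  moreover have "(s, s(i := s i - of_nat m)) \<in> (sem (Cmd (Asg i 1 i (- 1))))\<^sup>*"
  proof (induction m)
    case (Suc m)
    moreover have "(s(i := s i - of_nat m), s(i := s i - of_nat (Suc m))) \<in> sem (Cmd (Asg i 1 i (- 1)))"
      by (auto simp: fun_eq_iff)
    ultimately show ?case by (rule rtrancl_into_rtrancl)
  qed auto
  ultimately show "(s, s') \<in> sem (Star (Cmd (Asg i 1 i (- 1))))" by simp
qed

text \<open>Counting down to zero after one forced decrement succeeds only from a positive value.\<close>

definition assert_pos :: "nat \<Rightarrow> prog" where
  "assert_pos i = Seq (Cmd (Asg i 1 i (- 1))) (Seq (Star (Cmd (Asg i 1 i (- 1)))) (Cmd (Tst i)))"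

lemma sem_assert_pos:
  assumes "s i = of_nat v"
  shows "(s, s') \<in> sem (assert_pos i) \<longleftrightarrow> v > 0 \<and> s' = s(i := 0)"
proof
  assume "(s, s') \<in> sem (assert_pos i)"
  then obtain m :: nat where "s' = s(i := s i - 1 - of_nat m)" "s' i = 0"
    unfolding assert_pos_def sem.simps(2) relcomp.simps sem_Star_decr by auto
  moreover then have "of_nat v = (of_nat (Suc m) :: rat)" using assms by simp
  then have "v = Suc m" using of_nat_eq_iff by blast
  ultimately show "v > 0 \<and> s' = s(i := 0)" using assms by auto
next
  assume *: "v > 0 \<and> s' = s(i := 0)"
  then obtain m where m: "v = Suc m" using gr0_implies_Suc by blast
  have "(s(i := of_nat m), s(i := 0)) \<in> sem (Star (Cmd (Asg i 1 i (- 1))))"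
    unfolding sem_Star_decr by (intro exI[of _ m]) auto
  moreover have "(s, s(i := of_nat m)) \<in> sem (Cmd (Asg i 1 i (- 1)))"
    using assms m by (auto simp: fun_eq_iff)
  moreover have "(s(i := 0), s(i := 0)) \<in> sem (Cmd (Tst i))" by simp
  ultimately show "(s, s') \<in> sem (assert_pos i)"
    using * unfolding assert_pos_def sem.simps(2) by blast
qed

text \<open>Register \<open>n\<close> holds the candidate, \<open>n + 1\<close> the value of
  \<open>f\<close> there. A round ends only if this value is positive, and after the loop a fresh
  evaluation must give 0. A run that leaves the loop at a wrong candidate therefore never terminates
  successfully.\<close>

lemma computes_Minim:
  assumes f: "computes p f (n # as) (n + 1) (n + 2)"
    and as: "set as \<subseteq> {..<n}" and r: "r < n"
  shows "\<exists>p. computes p (Minim f) as r n"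
proof -
  let ?body = "Seq p (Seq (assert_pos (n + 1)) (Cmd (Asg n 1 n 1)))"
  let ?P = "Seq (Cmd (Asg n 0 0 0)) (Seq (Star ?body)
    (Seq p (Seq (Cmd (Tst (n + 1))) (Cmd (Asg r 1 n 0)))))"
  let ?inv = "\<lambda>(s::store) k (t::store). t n = of_nat k \<and> (\<forall>i<n. t i = s i)"
  have args: "map t (n # as) = map of_nat (k # xs)"
    if "map s as = map of_nat xs" "?inv s k t" for s t k xs
    using that(2) as map_store_cong[OF that(1), of t] by auto
  have body_sound: "(\<exists>v. eval f (k # xs) v \<and> v > 0) \<and> ?inv s (Suc k) t'"
    if xs: "map s as = map of_nat xs" and t: "?inv s k t" and "(t, t') \<in> sem ?body" for s xs k t t'
  proof -
    from that(3) obtain t1 t2 where t1: "(t, t1) \<in> sem p" and t2: "(t1, t2) \<in> sem (assert_pos (n + 1))"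
      and t': "t' = t2(n := t2 n + 1)" by auto
    from computes_sound[OF f args[OF xs t] t1] obtain v where v: "eval f (k # xs) v"
      "t1 (n + 1) = of_nat v" "\<And>i. i < n + 2 \<Longrightarrow> i \<noteq> n + 1 \<Longrightarrow> t1 i = t i" by metis
    have "v > 0" "t2 = t1(n + 1 := 0)" using t2 unfolding sem_assert_pos[of t1 "n + 1" v, OF v(2)] by auto
    then show ?thesis using v(1,3) t t' by auto
  qed
  have body_complete: "\<exists>t'. (t, t') \<in> sem ?body \<and> ?inv s (Suc k) t'"
    if xs: "map s as = map of_nat xs" and t: "?inv s k t" and "eval f (k # xs) v" "v > 0" for s xs k t v
  proof -
    from computes_complete[OF f args[OF xs t] that(3)] obtain t1 where t1: "(t, t1) \<in> sem p"
      "t1 (n + 1) = of_nat v" "\<And>i. i < n + 2 \<Longrightarrow> i \<noteq> n + 1 \<Longrightarrow> t1 i = t i" by metis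
    have "(t1, t1(n + 1 := 0)) \<in> sem (assert_pos (n + 1))"
      unfolding sem_assert_pos[of t1 "n + 1" v, OF t1(2)] using that(4) by simp
    then have "(t1, t1(n + 1 := 0, n := t1 n + 1)) \<in> sem (Seq (assert_pos (n + 1)) (Cmd (Asg n 1 n 1)))"
      by auto
    then have "(t, t1(n + 1 := 0, n := t1 n + 1)) \<in> sem ?body"
      by (auto intro!: relcompI[OF t1(1)])
    then show ?thesis using t1(3) t by (intro exI[of _ "t1(n + 1 := 0, n := t1 n + 1)"]) auto
  qed
  show ?thesis
  proof (intro exI[of _ ?P] computesI)
    fix s s' :: store and xs :: "nat list"
    assume xs: "map s as = map of_nat xs" and s': "(s, s') \<in> sem ?P"
    from s' obtain t t1 where t: "(s(n := 0), t) \<in> (sem ?body)\<^sup>*" and t1: "(t, t1) \<in> sem p"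
      and end_: "t1 (n + 1) = 0" "s' = t1(r := t1 n)" by auto
    from t have "\<exists>k. (\<forall>y<k. \<exists>v. eval f (y # xs) v \<and> v > 0) \<and> ?inv s k t"
    proof (induction rule: rtrancl_induct)
      case base
      show ?case by (intro exI[of _ 0]) auto
    next
      case (step t t')
      then obtain k where k: "\<forall>y<k. \<exists>v. eval f (y # xs) v \<and> v > 0" "?inv s k t" by blast
      from body_sound[OF xs k(2) step.hyps(2)] k(1) show ?case
        by (intro exI[of _ "Suc k"]) (auto simp: less_Suc_eq)
    qed
    then obtain k where k: "\<forall>y<k. \<exists>v. eval f (y # xs) v \<and> v > 0" "?inv s k t" by blast
    from computes_sound[OF f args[OF xs k(2)] t1] obtain v where v: "eval f (k # xs) v"
      "t1 (n + 1) = of_nat v" "\<And>i. i < n + 2 \<Longrightarrow> i \<noteq> n + 1 \<Longrightarrow> t1 i = t i" by metis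
    have "v = 0" using v(2) end_(1) by simp
    then have "eval (Minim f) xs k" using v(1) k(1) by (auto intro: eval_Minim)
    then show "\<exists>v. eval (Minim f) xs v \<and> s' r = of_nat v \<and> changes_only n r s s'"
      using end_(2) v(3) k(2) by (intro exI[of _ k]) (auto simp: changes_only_def)
  next
    fix s :: store and v and xs :: "nat list"
    assume xs: "map s as = map of_nat xs" and ev: "eval (Minim f) xs v"
    from ev have f0: "eval f (v # xs) 0" and pos: "\<forall>y<v. \<exists>w. eval f (y # xs) w \<and> w > 0"
      by (cases rule: eval.cases; simp)+
    have "k \<le> v \<Longrightarrow> \<exists>t. (s(n := 0), t) \<in> (sem ?body)\<^sup>* \<and> ?inv s k t" for k
    proof (induction k)
      case 0
      show ?case by (intro exI[of _ "s(n := 0)"]) auto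
    next
      case (Suc k)
      from Suc.IH[OF Suc_leD[OF Suc.prems]]
      obtain t where t: "(s(n := 0), t) \<in> (sem ?body)\<^sup>*" "?inv s k t" by blast
      from pos Suc.prems obtain w where "eval f (k # xs) w" "w > 0" by (auto simp: Suc_le_eq)
      from body_complete[OF xs t(2) this] t(1) show ?case by (meson rtrancl.rtrancl_into_rtrancl)
    qed
    then obtain t where t: "(s(n := 0), t) \<in> (sem ?body)\<^sup>*" "?inv s v t" by blast
    from computes_complete[OF f args[OF xs t(2)] f0] obtain t1 where t1: "(t, t1) \<in> sem p"
      "t1 (n + 1) = of_nat 0" "\<And>i. i < n + 2 \<Longrightarrow> i \<noteq> n + 1 \<Longrightarrow> t1 i = t i" by metis
    have "(t1, t1(r := t1 n)) \<in> sem (Seq (Cmd (Tst (n + 1))) (Cmd (Asg r 1 n 0)))"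
      using t1(2) by simp
    moreover have "(s, s(n := 0)) \<in> sem (Cmd (Asg n 0 0 0))" by simp
    ultimately have "(s, t1(r := t1 n)) \<in> sem ?P"
      using t(1) t1(1) unfolding sem.simps(2,3) by blast
    then show "\<exists>s'. (s, s') \<in> sem ?P \<and> s' r = of_nat v \<and> changes_only n r s s'"
      using t(2) t1(3) by (intro exI[of _ "t1(r := t1 n)"]) (auto simp: changes_only_def)
  qed
qed

text \<open>The results fill consecutive registers, ready to be the argument list of the outer
  function in a composition.\<close>

definition computes_list :: "prog \<Rightarrow> recf list \<Rightarrow> nat list \<Rightarrow> nat \<Rightarrow> bool" where
  "computes_list p gs as b \<longleftrightarrow> (\<forall>s xs. map s as = map of_nat xs \<longrightarrow>
     (\<forall>s'. (s, s') \<in> sem p \<longrightarrow> (\<exists>ys. list_all2 (\<lambda>g. eval g xs) gs ys \<and>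
        map s' [b..<b + length gs] = map of_nat ys \<and> (\<forall>i<b. s' i = s i))) \<and>
     (\<forall>ys. list_all2 (\<lambda>g. eval g xs) gs ys \<longrightarrow> (\<exists>s'. (s, s') \<in> sem p \<and>
        map s' [b..<b + length gs] = map of_nat ys \<and> (\<forall>i<b. s' i = s i))))"

lemma computes_list_sound:
  assumes "computes_list p gs as b" "map s as = map of_nat xs" "(s, s') \<in> sem p"
  obtains ys where "list_all2 (\<lambda>g. eval g xs) gs ys"
    "map s' [b..<b + length gs] = map of_nat ys" "\<And>i. i < b \<Longrightarrow> s' i = s i"
  using assms unfolding computes_list_def by blast

lemma computes_list_complete:
  assumes "computes_list p gs as b" "map s as = map of_nat xs" "list_all2 (\<lambda>g. eval g xs) gs ys"
  obtains s' where "(s, s') \<in> sem p"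
    "map s' [b..<b + length gs] = map of_nat ys" "\<And>i. i < b \<Longrightarrow> s' i = s i"
  using assms unfolding computes_list_def by blast

text \<open>The program for the head writes register \<open>b\<close> and uses scratch space from
  \<open>Suc b\<close>; the programs for the tail start at \<open>Suc b\<close> and so preserve that
  result as well as the arguments.\<close>

lemma computes_list_exists:
  assumes "\<And>g as r n. g \<in> set gs \<Longrightarrow> set as \<subseteq> {..<n} \<Longrightarrow> r < n \<Longrightarrow> \<exists>p. computes p g as r n"
    and "set as \<subseteq> {..<b}"
  shows "\<exists>p. computes_list p gs as b"
  using assms
proof (induction gs arbitrary: b)
  case Nil
  show ?case by (intro exI[of _ "Cmd skip"]) (auto simp: computes_list_def)
next
  case (Cons g gs)
  from Cons.prems(1)[of g as "Suc b" b] Cons.prems(2) obtain p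
    where p: "computes p g as b (Suc b)" by (auto simp: subset_iff less_Suc_eq)
  have as': "set as \<subseteq> {..<Suc b}" using Cons.prems(2) by (auto simp: less_Suc_eq)
  have "\<exists>q. computes_list q gs as (Suc b)"
    by (rule Cons.IH[OF _ as']) (use Cons.prems(1) in auto)
  then obtain q where q: "computes_list q gs as (Suc b)" ..
  have upt: "[b..<b + length (g # gs)] = b # [Suc b..<Suc b + length gs]"
    by (simp add: upt_rec)
  have "computes_list (Seq p q) (g # gs) as b"
    unfolding computes_list_def
  proof (intro allI impI conjI)
    fix s s' :: store and xs :: "nat list"
    assume xs: "map s as = map of_nat xs" and "(s, s') \<in> sem (Seq p q)"
    then obtain t where t: "(s, t) \<in> sem p" "(t, s') \<in> sem q" by auto
    from computes_sound[OF p xs t(1)] obtain v where v: "eval g xs v" "t b = of_nat v" "\<And>i. i < Suc b \<Longrightarrow> i \<noteq> b \<Longrightarrow> t i = s i" by metis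
    have "map t as = map of_nat xs"
      using v(3) Cons.prems(2) by (intro map_store_cong[OF xs]) (auto simp: subset_iff)
    from computes_list_sound[OF q this t(2)] obtain ys where "list_all2 (\<lambda>g. eval g xs) gs ys"
      "map s' [Suc b..<Suc b + length gs] = map of_nat ys" "\<And>i. i < Suc b \<Longrightarrow> s' i = t i" by metis
    then show "\<exists>ys. list_all2 (\<lambda>g. eval g xs) (g # gs) ys \<and>
        map s' [b..<b + length (g # gs)] = map of_nat ys \<and> (\<forall>i<b. s' i = s i)"
      using v unfolding upt by (intro exI[of _ "v # ys"]) auto
  next
    fix s :: store and xs ys' :: "nat list"
    assume xs: "map s as = map of_nat xs" and "list_all2 (\<lambda>g. eval g xs) (g # gs) ys'"
    then obtain v ys where ys': "ys' = v # ys" "eval g xs v" "list_all2 (\<lambda>g. eval g xs) gs ys"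
      by (auto simp: list_all2_Cons1)
    from computes_complete[OF p xs ys'(2)] obtain t where t: "(s, t) \<in> sem p" "t b = of_nat v" "\<And>i. i < Suc b \<Longrightarrow> i \<noteq> b \<Longrightarrow> t i = s i" by metis
    have "map t as = map of_nat xs"
      using t(3) Cons.prems(2) by (intro map_store_cong[OF xs]) (auto simp: subset_iff)
    from computes_list_complete[OF q this ys'(3)] obtain s' where "(t, s') \<in> sem q"
      "map s' [Suc b..<Suc b + length gs] = map of_nat ys" "\<And>i. i < Suc b \<Longrightarrow> s' i = t i" by metis
    then show "\<exists>s'. (s, s') \<in> sem (Seq p q) \<and>
        map s' [b..<b + length (g # gs)] = map of_nat ys' \<and> (\<forall>i<b. s' i = s i)"
      using t ys'(1) unfolding upt by (intro exI[of _ s']) auto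
  qed
  then show ?case ..
qed

text \<open>The inner results are placed at the start of the scratch space, and the scratch space of
  the outer program begins behind them.\<close>

lemma computes_Comp:
  assumes gs: "\<And>g as r n. g \<in> set gs \<Longrightarrow> set as \<subseteq> {..<n} \<Longrightarrow> r < n \<Longrightarrow> \<exists>p. computes p g as r n"
    and f: "\<And>as r n. set as \<subseteq> {..<n} \<Longrightarrow> r < n \<Longrightarrow> \<exists>p. computes p f as r n"
    and as: "set as \<subseteq> {..<n}" and r: "r < n"
  shows "\<exists>p. computes p (Comp f gs) as r n"
proof -
  have all2: "list_all2 (\<lambda>g. eval g xs) gs ys \<longleftrightarrow>
      length ys = length gs \<and> (\<forall>i<length gs. eval (gs ! i) xs (ys ! i))" for xs ys
    by (auto simp: list_all2_conv_all_nth)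
  have "\<exists>p. computes_list p gs as n"
    by (rule computes_list_exists[OF _ as]) (rule gs)
  then obtain p where p: "computes_list p gs as n" ..
  have "set [n..<n + length gs] \<subseteq> {..<n + length gs}" "r < n + length gs" using r by auto
  from f[OF this] obtain q where q: "computes q f [n..<n + length gs] r (n + length gs)" ..
  show ?thesis
  proof (intro exI[of _ "Seq p q"] computesI)
    fix s s' :: store and xs :: "nat list"
    assume xs: "map s as = map of_nat xs" and "(s, s') \<in> sem (Seq p q)"
    then obtain t where t: "(s, t) \<in> sem p" "(t, s') \<in> sem q" by auto
    from computes_list_sound[OF p xs t(1)] obtain ys where ys: "list_all2 (\<lambda>g. eval g xs) gs ys"
      "map t [n..<n + length gs] = map of_nat ys" "\<And>i. i < n \<Longrightarrow> t i = s i" by metis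
    from computes_sound[OF q ys(2) t(2)] obtain v where "eval f ys v" "s' r = of_nat v"
      "\<And>i. i < n + length gs \<Longrightarrow> i \<noteq> r \<Longrightarrow> s' i = t i" by metis
    then show "\<exists>v. eval (Comp f gs) xs v \<and> s' r = of_nat v \<and> changes_only n r s s'"
      using ys unfolding all2 by (intro exI[of _ v]) (auto simp: changes_only_def intro: eval_Comp)
  next
    fix s :: store and v and xs :: "nat list"
    assume xs: "map s as = map of_nat xs" and "eval (Comp f gs) xs v"
    from this(2) obtain ys where ys: "list_all2 (\<lambda>g. eval g xs) gs ys" "eval f ys v"
      unfolding all2 by (cases rule: eval.cases) auto
    from computes_list_complete[OF p xs ys(1)] obtain t where t: "(s, t) \<in> sem p"
      "map t [n..<n + length gs] = map of_nat ys" "\<And>i. i < n \<Longrightarrow> t i = s i" by metis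
    from computes_complete[OF q t(2) ys(2)] obtain s' where "(t, s') \<in> sem q" "s' r = of_nat v"
      "\<And>i. i < n + length gs \<Longrightarrow> i \<noteq> r \<Longrightarrow> s' i = t i" by metis
    then show "\<exists>s'. (s, s') \<in> sem (Seq p q) \<and> s' r = of_nat v \<and> changes_only n r s s'"
      using t by (intro exI[of _ s']) (auto simp: changes_only_def)
  qed
qed

text \<open>The induction keeps argument registers, target and scratch bound arbitrary, because each
  subprogram works with a layout of its own.\<close>

theorem recf_computable:
  assumes "set as \<subseteq> {..<n}" "r < n"
  shows "\<exists>p. computes p f as r n"
  using assms
proof (induction f arbitrary: as r n)
  case Zero
  show ?case
    by (intro exI[of _ "Cmd (Asg r 0 0 0)"] computesI)
      (auto simp: changes_only_def elim: eval.cases intro: eval_Zero)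
next
  case Succ
  show ?case
  proof (cases as)
    case Nil
    then show ?thesis by (intro exI[of _ stuck] computesI) (auto elim: eval.cases)
  next
    case (Cons a as')
    show ?thesis unfolding Cons
    proof (intro exI[of _ "Cmd (Asg r 1 a 1)"] computesI)
      fix s s' :: store and ys :: "nat list"
      assume "map s (a # as') = map of_nat ys" "(s, s') \<in> sem (Cmd (Asg r 1 a 1))"
      then show "\<exists>v. eval Succ ys v \<and> s' r = of_nat v \<and> changes_only n r s s'"
        by (intro exI[of _ "Suc (hd ys)"]) (auto simp: changes_only_def intro: eval_Succ)
    qed (auto simp: changes_only_def elim!: eval.cases[of Succ])
  qed
next
  case (Proj i)
  show ?case
  proof (cases "i < length as")
    case False
    show ?thesis
    proof (intro exI[of _ stuck] computesI)
      fix s :: store and xs v assume "map s as = map of_nat xs" "eval (Proj i) xs v"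
      then show "\<exists>s'. (s, s') \<in> sem stuck \<and> s' r = of_nat v \<and> changes_only n r s s'"
        using False map_eq_imp_length_eq by (fastforce elim: eval.cases)
    qed auto
  next
    case True
    have nth: "s (as ! i) = of_nat (xs ! i)" "i < length xs"
      if "map s as = map of_nat xs" for s :: store and xs
      using that True map_eq_imp_length_eq nth_map by metis+
    show ?thesis
      by (intro exI[of _ "Cmd (Asg r 1 (as ! i) 0)"] computesI)
        (auto simp: changes_only_def nth intro: eval_Proj elim!: eval.cases[of "Proj i"])
  qed
next
  case (Comp f gs)
  show ?case by (rule computes_Comp[OF Comp.IH(2) Comp.IH(1) Comp.prems])
next
  case (Prec f g)
  show ?case
  proof (cases as)
    case Nil
    then show ?thesis by (intro exI[of _ stuck] computesI) (auto elim: eval.cases)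
  next
    case (Cons a as')
    have "set as' \<subseteq> {..<n + 4}" "set ((n + 1) # n # as') \<subseteq> {..<n + 4}"
      using Prec.prems(1) Cons by (auto simp: subset_iff)
    then obtain p q where "computes p f as' n (n + 4)" "computes q g ((n + 1) # n # as') (n + 3) (n + 4)"
      using Prec.IH(1)[of as' "n + 4" n] Prec.IH(2)[of "(n + 1) # n # as'" "n + 4" "n + 3"] by auto
    then show ?thesis using computes_Prec Prec.prems unfolding Cons by blast
  qed
next
  case (Minim f)
  have "set (n # as) \<subseteq> {..<n + 2}" using Minim.prems(1) by (auto simp: subset_iff)
  then obtain p where "computes p f (n # as) (n + 1) (n + 2)"
    using Minim.IH[of "n # as" "n + 2" "n + 1"] by auto
  then show ?case using computes_Minim Minim.prems by blast
qed

section \<open>Compiling programs to labelled transition systems\<close>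

section \<open>Labelled transitions\<close>

type_synonym trans = "nat \<times> cmd \<times> nat"

definition step :: "trans set \<Rightarrow> ((nat \<times> store) \<times> (nat \<times> store)) set" where
  "step T = {((q, s), (q', s')). \<exists>c. (q, c, q') \<in> T \<and> (s, s') \<in> cmd_sem c}"

lemma rtrancl_step_mono: "x \<in> (step T)\<^sup>* \<Longrightarrow> T \<subseteq> T' \<Longrightarrow> x \<in> (step T')\<^sup>*"
  using rtrancl_mono[of "step T" "step T'"] by (auto simp: step_def)

fun plen :: "prog \<Rightarrow> nat" where
  "plen (Cmd c) = 1"
| "plen (Seq p q) = plen p + plen q"
| "plen (Star p) = plen p + 2"

text \<open>A loop gets an entry and an exit label of its own besides the head \<open>l + 1\<close>;
  otherwise the back edge would lead into the entry label.\<close>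

fun flat :: "prog \<Rightarrow> nat \<Rightarrow> trans list" where
  "flat (Cmd c) l = [(l, c, l + 1)]"
| "flat (Seq p q) l = flat p l @ flat q (l + plen p)"
| "flat (Star p) l = (l, skip, l + 1) # (l + 1 + plen p, skip, l + 1) # (l + 1, skip, l + plen p + 2) # flat p (l + 1)"

lemma plen_pos: "plen p > 0"
  by (induction p) auto

text \<open>In particular nothing enters the entry label and nothing leaves the exit label. This is
  what makes it sound to glue two fragments at a shared label.\<close>

lemma flat_labels: "(q, c, q') \<in> set (flat p l) \<Longrightarrow> l \<le> q \<and> q < l + plen p \<and> l < q' \<and> q' \<le> l + plen p"
proof (induction p l rule: flat.induct)
  case (2 p q l)
  then show ?case using plen_pos[of p] plen_pos[of q] by fastforce
next
  case (3 p l)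
  then show ?case using plen_pos[of p] by fastforce
qed auto

lemma flat_complete: "(s, s') \<in> sem p \<Longrightarrow> ((l, s), (l + plen p, s')) \<in> (step (set (flat p l)))\<^sup>*"
proof (induction p arbitrary: l s s')
  case (Cmd c)
  then show ?case by (auto simp: step_def)
next
  case (Seq p q)
  from Seq.prems obtain t where t: "(s, t) \<in> sem p" "(t, s') \<in> sem q" by auto
  have "((l, s), (l + plen p, t)) \<in> (step (set (flat (Seq p q) l)))\<^sup>*"
    by (rule rtrancl_step_mono[OF Seq.IH(1)[OF t(1)]]) auto
  moreover have "((l + plen p, t), (l + plen p + plen q, s')) \<in> (step (set (flat (Seq p q) l)))\<^sup>*"
    by (rule rtrancl_step_mono[OF Seq.IH(2)[OF t(2)]]) auto
  ultimately show ?case by (simp add: add.assoc)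
next
  case (Star p)
  let ?R = "step (set (flat (Star p) l))"
  from Star.prems have "(s, s') \<in> (sem p)\<^sup>*" by simp
  then have "((l + 1, s), (l + 1, s')) \<in> ?R\<^sup>*"
  proof (induction rule: rtrancl_induct)
    case (step t t')
    have "((l + 1, t), (l + 1 + plen p, t')) \<in> ?R\<^sup>*"
      by (rule rtrancl_step_mono[OF Star.IH[OF step.hyps(2)]]) auto
    moreover have "((l + 1 + plen p, t'), (l + 1, t')) \<in> ?R"
      by (auto simp: step_def intro!: exI[of _ skip])
    ultimately show ?case using step.IH by (meson rtrancl.rtrancl_into_rtrancl rtrancl_trans)
  qed simp
  moreover have "((l, s), (l + 1, s)) \<in> ?R" "((l + 1, s'), (l + plen (Star p), s')) \<in> ?R"
    by (auto simp: step_def intro!: exI[of _ skip])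
  ultimately show ?case by (meson converse_rtrancl_into_rtrancl rtrancl.rtrancl_into_rtrancl)
qed

lemma flat_sound: "((l, s), (l + plen p, s')) \<in> (step (set (flat p l)))\<^sup>* \<Longrightarrow> (s, s') \<in> sem p"
proof (induction p arbitrary: l s s')
  case (Cmd c)
  from Cmd.prems obtain x where x: "((l, s), x) \<in> step (set (flat (Cmd c) l))"
    "(x, (l + 1, s')) \<in> (step (set (flat (Cmd c) l)))\<^sup>*"
    by (auto elim: converse_rtranclE)
  from x(2,1) have "x = (l + 1, s')"
    by (cases rule: converse_rtranclE) (auto simp: step_def)
  then show ?case using x(1) by (auto simp: step_def)
next
  case (Seq p q)
  let ?P = "set (flat p l)" and ?Q = "set (flat q (l + plen p))"
  \<comment> \<open>Once label \<open>l + plen p\<close> is reached the first fragment is left for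
    good, and its run is replaced by a pair in \<open>sem p\<close>.\<close>
  let ?I = "\<lambda>k t. (k < l + plen p \<and> ((l, s), (k, t)) \<in> (step ?P)\<^sup>*) \<or>
     (k \<ge> l + plen p \<and> (\<exists>u. (s, u) \<in> sem p \<and> ((l + plen p, u), (k, t)) \<in> (step ?Q)\<^sup>*))"
  have "?I k t" if "((l, s), (k, t)) \<in> (step (set (flat (Seq p q) l)))\<^sup>*" for k t
    using that
  proof (induction rule: rtrancl_induct2)
    case refl
    show ?case using plen_pos[of p] by auto
  next
    case (step k t k' t')
    from step.hyps(2) consider "((k, t), (k', t')) \<in> step ?P" | "((k, t), (k', t')) \<in> step ?Q"
      by (auto simp: step_def)
    then show ?case
    proof cases
      case 1
      then have k: "k < l + plen p" "k' \<le> l + plen p" by (auto simp: step_def dest: flat_labels)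
      with step.IH have path: "((l, s), (k', t')) \<in> (step ?P)\<^sup>*"
        using 1 by (auto intro: rtrancl_into_rtrancl)
      show ?thesis
      proof (cases "k' = l + plen p")
        case True
        then show ?thesis using Seq.IH(1)[of l s t'] path by auto
      next
        case False
        then show ?thesis using path k by auto
      qed
    next
      case 2
      then have "k \<ge> l + plen p" "k' \<ge> l + plen p" by (auto simp: step_def dest: flat_labels)
      then show ?thesis using step.IH 2 by (meson leD rtrancl.rtrancl_into_rtrancl)
    qed
  qed
  from this[of "l + plen (Seq p q)" s'] Seq.prems obtain u where "(s, u) \<in> sem p"
    "((l + plen p, u), (l + plen p + plen q, s')) \<in> (step ?Q)\<^sup>*" by (auto simp: add.assoc)
  then show ?case using Seq.IH(2) by auto
next
  case (Star p)
  let ?P = "set (flat p (l + 1))"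
  \<comment> \<open>The cases are entry, loop head, inside a round, exit. The end of the body
    belongs to the third case; its round turns into a pair in \<open>sem p\<close> when the back
    edge is taken.\<close>
  let ?I = "\<lambda>k t. (k = l \<and> t = s) \<or> (k = l + 1 \<and> (s, t) \<in> (sem p)\<^sup>*) \<or>
     (l + 1 < k \<and> k \<le> l + 1 + plen p \<and> (\<exists>u. (s, u) \<in> (sem p)\<^sup>* \<and> ((l + 1, u), (k, t)) \<in> (step ?P)\<^sup>*)) \<or>
     (k = l + plen p + 2 \<and> (s, t) \<in> (sem p)\<^sup>*)"
  have "?I k t" if "((l, s), (k, t)) \<in> (step (set (flat (Star p) l)))\<^sup>*" for k t
    using that
  proof (induction rule: rtrancl_induct2)
    case refl
    show ?case by auto
  next
    case (step k t k' t')
    from step.hyps(2) consider "k = l" "k' = l + 1" "t' = t" | "k = l + 1 + plen p" "k' = l + 1" "t' = t"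
      | "k = l + 1" "k' = l + plen p + 2" "t' = t" | "((k, t), (k', t')) \<in> step ?P"
      by (auto simp: step_def)
    then show ?case
    proof cases
      case 1
      then show ?thesis using step.IH plen_pos[of p] by auto
    next
      case 2
      then obtain u where "(s, u) \<in> (sem p)\<^sup>*" "((l + 1, u), (l + 1 + plen p, t)) \<in> (step ?P)\<^sup>*"
        using step.IH plen_pos[of p] by auto
      then have "(s, t) \<in> (sem p)\<^sup>*"
        using Star.IH[of "l + 1" u t] by (auto intro: rtrancl_into_rtrancl)
      then show ?thesis using 2 by auto
    next
      case 3
      then show ?thesis using step.IH plen_pos[of p] by auto
    next
      case 4
      then have k: "l + 1 \<le> k" "k < l + 1 + plen p" "l + 1 < k'" "k' \<le> l + 1 + plen p"
        by (auto simp: step_def dest!: flat_labels)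
      then obtain u where "(s, u) \<in> (sem p)\<^sup>*" "((l + 1, u), (k, t)) \<in> (step ?P)\<^sup>*"
        using step.IH by auto
      then have "(s, u) \<in> (sem p)\<^sup>*" "((l + 1, u), (k', t')) \<in> (step ?P)\<^sup>*"
        using 4 by (auto intro: rtrancl_into_rtrancl)
      then show ?thesis using k by blast
    qed
  qed
  from this[of "l + plen (Star p)" s'] Star.prems show ?case by auto
qed

section \<open>Linear action of letters on registers and their squares\<close>

section \<open>Letters acting on register vectors\<close>

text \<open>Coordinate 0 of a row vector carries the constant 1, coordinates \<open>2 * i + 1\<close> and \<open>2 * i + 2\<close>
  carry the value of register \<open>i\<close> and its square, and coordinate \<open>2 * N + 1\<close> accumulates penalties.
  The entry at \<open>(2 * N + 2, 0)\<close> of a product depends only on its first factor, the entry at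
  \<open>(2 * N + 1, 2 * N + 3)\<close> only on its last one.\<close>

definition column :: "nat \<Rightarrow> rat \<Rightarrow> (nat \<Rightarrow> rat) \<Rightarrow> (nat \<Rightarrow> rat) \<Rightarrow> rat \<Rightarrow> rat \<Rightarrow> nat \<Rightarrow> rat" where
  "column N x f g z w k =
    (if k = 0 then x
     else if k \<le> 2 * N then (if odd k then f (k div 2) else g (k div 2 - 1))
     else if k = 2 * N + 1 then z else if k = 2 * N + 2 then w else 0)"

lemma sum_odd_even:
  "(\<Sum>k<2 * N + 1. h k) = h 0 + (\<Sum>i<N. h (2 * i + 1) + h (2 * i + 2) :: rat)" for h :: "nat \<Rightarrow> rat"
  by (induction N) (auto simp: algebra_simps)

lemma sum_column:
  "(\<Sum>k<2 * N + 4. y k * column N x f g z w k) =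
    y 0 * x + (\<Sum>i<N. y (2 * i + 1) * f i + y (2 * i + 2) * g i) + y (2 * N + 1) * z + y (2 * N + 2) * w"
proof -
  have *: "(\<Sum>k<2 * N + 4. h k) = (\<Sum>k<2 * N + 1. h k) + h (2 * N + 1) + h (2 * N + 2) + h (2 * N + 3)"
    for h :: "nat \<Rightarrow> rat"
    by (simp add: eval_nat_numeral)
  have "(\<Sum>k<2 * N + 4. y k * column N x f g z w k) =
      (\<Sum>k<2 * N + 1. y k * column N x f g z w k) + y (2 * N + 1) * z + y (2 * N + 2) * w"
    unfolding * by (simp add: column_def)
  also have "(\<Sum>k<2 * N + 1. y k * column N x f g z w k) =
      y 0 * x + (\<Sum>i<N. y (2 * i + 1) * f i + y (2 * i + 2) * g i)"
    unfolding sum_odd_even by (auto simp: column_def intro!: sum.cong)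
  finally show ?thesis .
qed

text \<open>The penalty is a polynomial without mixed terms, since a row carries only the registers
  and their squares. The last two fields mark which letters may begin and end a word.\<close>

datatype letter = Letter
  (coef: "nat \<Rightarrow> rat") (src: "nat \<Rightarrow> nat") (const: "nat \<Rightarrow> rat")
  (pen0: rat) (pen1: "nat \<Rightarrow> rat") (pen2: "nat \<Rightarrow> rat")
  (first_entry: rat) (last_entry: rat)

definition update :: "letter \<Rightarrow> (nat \<Rightarrow> rat) \<Rightarrow> nat \<Rightarrow> rat" where
  "update a S i = coef a i * S (src a i) + const a i"

definition penalty :: "nat \<Rightarrow> letter \<Rightarrow> (nat \<Rightarrow> rat) \<Rightarrow> rat" where
  "penalty N a S = pen0 a + (\<Sum>i<N. pen1 a i * S i + pen2 a i * (S i)\<^sup>2)"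

text \<open>Row vectors are multiplied from the right, so column \<open>j\<close> tells how the new
  coordinate \<open>j\<close> arises from the old ones. The columns of the squares expand the square
  of \<open>a * x + c\<close>.\<close>

definition letter_mat :: "nat \<Rightarrow> letter \<Rightarrow> rat mat" where
  "letter_mat N a = mat (2 * N + 4) (2 * N + 4) (\<lambda>(k, j).
    (if j = 0 then column N 1 (\<lambda>_. 0) (\<lambda>_. 0) 0 (first_entry a)
     else if j \<le> 2 * N \<and> odd j then
       (let i = j div 2 in column N (const a i) (\<lambda>k. if k = src a i then coef a i else 0) (\<lambda>_. 0) 0 0)
     else if j \<le> 2 * N then
       (let i = j div 2 - 1 in column N ((const a i)\<^sup>2)
         (\<lambda>k. if k = src a i then 2 * coef a i * const a i else 0)
         (\<lambda>k. if k = src a i then (coef a i)\<^sup>2 else 0) 0 0)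
     else if j = 2 * N + 1 then column N (pen0 a) (pen1 a) (pen2 a) 1 0
     else if j = 2 * N + 2 then column N 0 (\<lambda>_. 0) (\<lambda>_. 0) 0 0
     else column N 0 (\<lambda>_. 0) (\<lambda>_. 0) (last_entry a) 0) k)"

lemma letter_mat_carrier [simp]: "letter_mat N a \<in> carrier_mat (2 * N + 4) (2 * N + 4)"
  by (simp add: letter_mat_def)

lemma letter_mat_dim [simp]:
  "dim_row (letter_mat N a) = 2 * N + 4" "dim_col (letter_mat N a) = 2 * N + 4"
  by (simp_all add: letter_mat_def)

text \<open>Stated for an arbitrary row: the same formulas serve row 0, which simulates, row
  \<open>2 * N + 1\<close>, which detects the last letter, and row \<open>2 * N + 2\<close>, which
  detects the first one.\<close>

lemma mult_letter_mat:
  assumes B: "B \<in> carrier_mat (2 * N + 4) (2 * N + 4)" and i: "i < 2 * N + 4"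
  shows "(B * letter_mat N a) $$ (i, 0) = B $$ (i, 0) + B $$ (i, 2 * N + 2) * first_entry a"
    and "m < N \<Longrightarrow> src a m < N \<Longrightarrow> (B * letter_mat N a) $$ (i, 2 * m + 1) =
      B $$ (i, 0) * const a m + B $$ (i, 2 * src a m + 1) * coef a m"
    and "m < N \<Longrightarrow> src a m < N \<Longrightarrow> (B * letter_mat N a) $$ (i, 2 * m + 2) =
      B $$ (i, 0) * (const a m)\<^sup>2 + B $$ (i, 2 * src a m + 1) * (2 * coef a m * const a m) +
      B $$ (i, 2 * src a m + 2) * (coef a m)\<^sup>2"
    and "(B * letter_mat N a) $$ (i, 2 * N + 1) = B $$ (i, 0) * pen0 a +
      (\<Sum>k<N. B $$ (i, 2 * k + 1) * pen1 a k + B $$ (i, 2 * k + 2) * pen2 a k) + B $$ (i, 2 * N + 1)"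
    and "(B * letter_mat N a) $$ (i, 2 * N + 2) = 0"
    and "(B * letter_mat N a) $$ (i, 2 * N + 3) = B $$ (i, 2 * N + 1) * last_entry a"
proof -
  have *: "(B * letter_mat N a) $$ (i, j) = (\<Sum>k<2 * N + 4. B $$ (i, k) * letter_mat N a $$ (k, j))"
    if "j < 2 * N + 4" for j
    using B i that by (simp add: scalar_prod_def atLeast0LessThan)
  have col: "(B * letter_mat N a) $$ (i, j) =
      B $$ (i, 0) * x + (\<Sum>k<N. B $$ (i, 2 * k + 1) * f k + B $$ (i, 2 * k + 2) * g k) +
      B $$ (i, 2 * N + 1) * z + B $$ (i, 2 * N + 2) * w"
    if "j < 2 * N + 4" "\<And>k. k < 2 * N + 4 \<Longrightarrow> letter_mat N a $$ (k, j) = column N x f g z w k"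
    for j x f g z w
    unfolding *[OF that(1)] sum_column[where y = "\<lambda>k. B $$ (i, k)", symmetric]
    using that(2) by (intro sum.cong) auto
  have delta: "(\<Sum>k<N. B $$ (i, 2 * k + 1) * (if k = m then u else 0) +
      B $$ (i, 2 * k + 2) * (if k = m then v else 0)) = B $$ (i, 2 * m + 1) * u + B $$ (i, 2 * m + 2) * v"
    if "m < N" for m u v
    using that by (simp add: sum.distrib if_distrib[of "\<lambda>x. _ * x"] cong: if_cong)
  show "(B * letter_mat N a) $$ (i, 0) = B $$ (i, 0) + B $$ (i, 2 * N + 2) * first_entry a"
    by (subst col[of 0 1 "\<lambda>_. 0" "\<lambda>_. 0" 0 "first_entry a"]) (auto simp: letter_mat_def)
  show "(B * letter_mat N a) $$ (i, 2 * N + 1) = B $$ (i, 0) * pen0 a +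
      (\<Sum>k<N. B $$ (i, 2 * k + 1) * pen1 a k + B $$ (i, 2 * k + 2) * pen2 a k) + B $$ (i, 2 * N + 1)"
    by (subst col[of _ "pen0 a" "pen1 a" "pen2 a" 1 0]) (auto simp: letter_mat_def)
  show "(B * letter_mat N a) $$ (i, 2 * N + 2) = 0"
    by (subst col[of _ 0 "\<lambda>_. 0" "\<lambda>_. 0" 0 0]) (auto simp: letter_mat_def)
  show "(B * letter_mat N a) $$ (i, 2 * N + 3) = B $$ (i, 2 * N + 1) * last_entry a"
    by (subst col[of _ 0 "\<lambda>_. 0" "\<lambda>_. 0" "last_entry a" 0]) (auto simp: letter_mat_def)
  assume m: "m < N" "src a m < N"
  show "(B * letter_mat N a) $$ (i, 2 * m + 1) =
      B $$ (i, 0) * const a m + B $$ (i, 2 * src a m + 1) * coef a m"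
    using m delta[OF m(2), of "coef a m" 0]
    by (subst col[of _ "const a m" "\<lambda>k. if k = src a m then coef a m else 0" "\<lambda>_. 0" 0 0])
      (auto simp: letter_mat_def)
  show "(B * letter_mat N a) $$ (i, 2 * m + 2) =
      B $$ (i, 0) * (const a m)\<^sup>2 + B $$ (i, 2 * src a m + 1) * (2 * coef a m * const a m) +
      B $$ (i, 2 * src a m + 2) * (coef a m)\<^sup>2"
    using m delta[OF m(2), of "2 * coef a m * const a m" "(coef a m)\<^sup>2"]
    by (subst col[of _ "(const a m)\<^sup>2" "\<lambda>k. if k = src a m then 2 * coef a m * const a m else 0"
          "\<lambda>k. if k = src a m then (coef a m)\<^sup>2 else 0" 0 0])
      (auto simp: letter_mat_def)
qed

lemma index_cases:
  fixes j N :: nat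
  assumes "j < 2 * N + 4"
  obtains "j = 0" | m where "m < N" "j = 2 * m + 1" | m where "m < N" "j = 2 * m + 2"
    | "j = 2 * N + 1" | "j = 2 * N + 2" | "j = 2 * N + 3"
proof -
  have "j = 0 \<or> (0 < j \<and> j \<le> 2 * N) \<or> j = 2 * N + 1 \<or> j = 2 * N + 2 \<or> j = 2 * N + 3"
    using assms by linarith
  then consider "j = 0" | "0 < j" "j \<le> 2 * N" "odd j" | "0 < j" "j \<le> 2 * N" "even j"
    | "j = 2 * N + 1" | "j = 2 * N + 2" | "j = 2 * N + 3"
    by blast
  then show ?thesis
  proof cases
    case 2
    then have "j div 2 < N" "j = 2 * (j div 2) + 1" by (auto elim!: oddE)
    then show ?thesis using that(2) by blast
  next
    case 3
    then have "j div 2 - 1 < N" "j = 2 * (j div 2 - 1) + 2" by (auto elim!: evenE)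
    then show ?thesis using that(3) by blast
  qed (use that in blast)+
qed

definition config_row :: "nat \<Rightarrow> (nat \<Rightarrow> rat) \<Rightarrow> (nat \<Rightarrow> rat) \<Rightarrow> rat \<Rightarrow> bool" where
  "config_row N y S x \<longleftrightarrow> y 0 = 1 \<and> (\<forall>i<N. y (2 * i + 1) = S i \<and> y (2 * i + 2) = (S i)\<^sup>2) \<and>
     y (2 * N + 1) = x \<and> y (2 * N + 2) = 0"

definition wf_letter :: "nat \<Rightarrow> letter \<Rightarrow> bool" where
  "wf_letter N a \<longleftrightarrow> (\<forall>i<N. src a i < N)"

lemma config_row_mult:
  assumes B: "B \<in> carrier_mat (2 * N + 4) (2 * N + 4)" and i: "i < 2 * N + 4" and wf: "wf_letter N a"
    and c: "config_row N (\<lambda>j. B $$ (i, j)) S x"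
  shows "config_row N (\<lambda>j. (B * letter_mat N a) $$ (i, j)) (update a S) (x + penalty N a S)"
proof -
  note M = mult_letter_mat[OF B i, where a = a]
  have y: "B $$ (i, 0) = 1" "B $$ (i, 2 * N + 1) = x" "B $$ (i, 2 * N + 2) = 0"
    "\<And>k. k < N \<Longrightarrow> B $$ (i, 2 * k + 1) = S k" "\<And>k. k < N \<Longrightarrow> B $$ (i, 2 * k + 2) = (S k)\<^sup>2"
    using c by (auto simp: config_row_def)
  have "(\<Sum>k<N. B $$ (i, 2 * k + 1) * pen1 a k + B $$ (i, 2 * k + 2) * pen2 a k) =
      (\<Sum>k<N. S k * pen1 a k + (S k)\<^sup>2 * pen2 a k)"
    by (intro sum.cong) (auto simp: y[simplified])
  then have acc: "(B * letter_mat N a) $$ (i, 2 * N + 1) = x + penalty N a S"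
    unfolding M(4) y by (simp add: penalty_def mult.commute)
  have val: "(B * letter_mat N a) $$ (i, 2 * m + 1) = update a S m"
    and sq: "(B * letter_mat N a) $$ (i, 2 * m + 2) = (update a S m)\<^sup>2" if "m < N" for m
  proof -
    have src: "src a m < N" using wf that by (simp add: wf_letter_def)
    show "(B * letter_mat N a) $$ (i, 2 * m + 1) = update a S m"
      unfolding M(2)[OF that src] y(1) y(4)[OF src] by (simp add: update_def)
    show "(B * letter_mat N a) $$ (i, 2 * m + 2) = (update a S m)\<^sup>2"
      unfolding M(3)[OF that src] y(1) y(4,5)[OF src]
      by (simp add: update_def power2_eq_square algebra_simps)
  qed
  show ?thesis
    unfolding config_row_def M(1,5) acc y using val sq by simp
qed

section \<open>Rows of products of letters\<close>

definition word_prod :: "nat \<Rightarrow> letter list \<Rightarrow> rat mat" where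
  "word_prod N ws = foldl (\<lambda>B a. B * letter_mat N a) (1\<^sub>m (2 * N + 4)) ws"

lemma word_prod_Nil [simp]: "word_prod N [] = 1\<^sub>m (2 * N + 4)"
  by (simp add: word_prod_def)

lemma word_prod_snoc [simp]: "word_prod N (ws @ [a]) = word_prod N ws * letter_mat N a"
  by (simp add: word_prod_def)

lemma word_prod_single [simp]: "word_prod N [a] = letter_mat N a"
  using word_prod_snoc[of N "[]" a] by (simp add: left_mult_one_mat[OF letter_mat_carrier])

lemma word_prod_carrier [simp]: "word_prod N ws \<in> carrier_mat (2 * N + 4) (2 * N + 4)"
  by (induction ws rule: rev_induct) auto

text \<open>The empty word must be excluded: its product is the identity, which is nonnegative but
  need not lie in the semigroup.\<close>

lemma gen_semigroup_letters:
  "gen_semigroup (map (letter_mat N) Ls) = {word_prod N ws | ws. ws \<noteq> [] \<and> set ws \<subseteq> set Ls}"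
proof (intro equalityI subsetI)
  fix B assume "B \<in> gen_semigroup (map (letter_mat N) Ls)"
  then show "B \<in> {word_prod N ws | ws. ws \<noteq> [] \<and> set ws \<subseteq> set Ls}"
  proof induction
    case (gen M)
    then obtain a where "a \<in> set Ls" "M = word_prod N [a]" by auto
    then show ?case by (intro CollectI exI[of _ "[a]"]) auto
  next
    case (mult A M)
    then obtain ws a where "ws \<noteq> []" "set ws \<subseteq> set Ls" "A = word_prod N ws" "a \<in> set Ls"
      "M = letter_mat N a" by auto
    then show ?case by (intro CollectI exI[of _ "ws @ [a]"]) auto
  qed
next
  fix B assume "B \<in> {word_prod N ws | ws. ws \<noteq> [] \<and> set ws \<subseteq> set Ls}"
  then obtain ws where "B = word_prod N ws" "ws \<noteq> []" "set ws \<subseteq> set Ls" by blast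
  moreover have "ws \<noteq> [] \<Longrightarrow> set ws \<subseteq> set Ls \<Longrightarrow> word_prod N ws \<in> gen_semigroup (map (letter_mat N) Ls)"
  proof (induction ws rule: rev_induct)
    case (snoc a ws)
    then show ?case by (cases "ws = []") (auto intro: gen_semigroup.intros)
  qed simp
  ultimately show "B \<in> gen_semigroup (map (letter_mat N) Ls)" by blast
qed

text \<open>The start value reflects row 0 of the identity matrix: registers and accumulator are
  0.\<close>

definition run :: "nat \<Rightarrow> letter list \<Rightarrow> (nat \<Rightarrow> rat) \<times> rat" where
  "run N ws = foldl (\<lambda>(S, x) a. (update a S, x + penalty N a S)) (\<lambda>_. 0, 0) ws"

lemma run_Nil [simp]: "run N [] = (\<lambda>_. 0, 0)"
  by (simp add: run_def)

lemma run_snoc [simp]: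
  "run N (ws @ [a]) = (update a (fst (run N ws)), snd (run N ws) + penalty N a (fst (run N ws)))"
  by (simp add: run_def split_beta)

lemma word_prod_row_0:
  assumes "\<forall>a\<in>set ws. wf_letter N a"
  shows "config_row N (\<lambda>j. word_prod N ws $$ (0, j)) (fst (run N ws)) (snd (run N ws))"
  using assms
proof (induction ws rule: rev_induct)
  case Nil
  show ?case by (auto simp: config_row_def)
next
  case (snoc a ws)
  then show ?case using config_row_mult[of "word_prod N ws" N 0 a] by simp
qed

text \<open>Column \<open>2 * N + 2\<close> of every letter is zero. So this row meets a
  \<open>first_entry\<close> only at the first factor, and later factors copy the entry in column
  0.\<close>

lemma word_prod_first:
  assumes "ws \<noteq> []"
  shows "word_prod N ws $$ (2 * N + 2, 0) = first_entry (hd ws) \<and> word_prod N ws $$ (2 * N + 2, 2 * N + 2) = 0"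
  using assms
proof (induction ws rule: rev_induct)
  case (snoc a ws)
  have M: "(word_prod N ws * letter_mat N a) $$ (2 * N + 2, 0) =
      word_prod N ws $$ (2 * N + 2, 0) + word_prod N ws $$ (2 * N + 2, 2 * N + 2) * first_entry a"
    "(word_prod N ws * letter_mat N a) $$ (2 * N + 2, 2 * N + 2) = 0"
    by (intro mult_letter_mat; simp)+
  show ?case
  proof (cases "ws = []")
    case True
    then show ?thesis using M by simp
  next
    case False
    then show ?thesis using M snoc.IH by simp
  qed
qed simp

text \<open>This row has 0 in place of the constant 1, so neither constants nor penalties ever enter
  it. The bound on \<open>j\<close> leaves out the column of \<open>last_entry\<close>.\<close>

lemma word_prod_row_acc:
  assumes "\<forall>a\<in>set ws. wf_letter N a" "j \<le> 2 * N + 2"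
  shows "word_prod N ws $$ (2 * N + 1, j) = (if j = 2 * N + 1 then 1 else 0)"
  using assms
proof (induction ws arbitrary: j rule: rev_induct)
  case (snoc a ws)
  note M = mult_letter_mat[where B = "word_prod N ws" and i = "2 * N + 1" and a = a, OF word_prod_carrier, simplified]
  have wf: "wf_letter N a" using snoc.prems by simp
  have IH: "word_prod N ws $$ (Suc (2 * N), j) = (if j = 2 * N + 1 then 1 else 0)" if "j \<le> 2 * N + 2" for j
    using snoc.IH[OF _ that] snoc.prems(1) by simp
  from snoc.prems(2) have "j < 2 * N + 4" by simp
  then show ?case
    by (cases rule: index_cases)
      (use wf snoc.prems(2) in \<open>auto simp: M IH wf_letter_def\<close>)
qed auto

text \<open>Every factor recomputes column \<open>2 * N + 3\<close> from the accumulator column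
  alone, where this row has a 1; hence only the last factor counts.\<close>

lemma word_prod_last:
  assumes "\<forall>a\<in>set ws. wf_letter N a" "ws \<noteq> []"
  shows "word_prod N ws $$ (2 * N + 1, 2 * N + 3) = last_entry (last ws)"
proof -
  obtain us a where ws: "ws = us @ [a]" using assms(2) by (metis rev_exhaust)
  have "(word_prod N us * letter_mat N a) $$ (2 * N + 1, 2 * N + 3) =
      word_prod N us $$ (2 * N + 1, 2 * N + 1) * last_entry a"
    by (intro mult_letter_mat) auto
  then show ?thesis using word_prod_row_acc[of us N "2 * N + 1"] assms(1) ws by simp
qed

text \<open>Under the assumptions the letter has nonzero entries only in rows 0 and
  \<open>2 * N + 1\<close>, and a zero row stays zero under multiplication from the right. Applied
  to \<open>init_letter\<close>, this leaves two rows to check in an accepting product.\<close>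

lemma word_prod_zero_rows:
  assumes "\<And>i. coef a i = 0" "\<And>i. pen1 a i = 0" "\<And>i. pen2 a i = 0" "first_entry a = 0"
    and "0 < i" "i \<noteq> 2 * N + 1" "i < 2 * N + 4" "j < 2 * N + 4"
  shows "word_prod N (a # ws) $$ (i, j) = 0"
  using assms(8)
proof (induction ws arbitrary: j rule: rev_induct)
  case Nil
  then show ?case
    using assms by (auto simp: letter_mat_def column_def Let_def cong: if_cong)
next
  case (snoc b ws)
  have "(word_prod N (a # ws) * letter_mat N b) $$ (i, j) =
      (\<Sum>k<2 * N + 4. word_prod N (a # ws) $$ (i, k) * letter_mat N b $$ (k, j))"
    using carrier_matD[OF word_prod_carrier[of N "a # ws"]] assms(7) snoc.prems
    by (simp add: scalar_prod_def atLeast0LessThan)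
  then show ?case using snoc.IH word_prod_snoc[of N "a # ws" b] by simp
qed

section \<open>Letters for the input, the transitions and the final label\<close>

section \<open>Transitions as letters\<close>

text \<open>Register 0 holds the label, register \<open>Suc i\<close> holds register \<open>i\<close> of the store.\<close>

definition config :: "nat \<times> store \<Rightarrow> nat \<Rightarrow> rat" where
  "config c = case_nat (of_nat (fst c)) (snd c)"

text \<open>The penalty coefficients expand minus the square of \<open>S 0 - q\<close>, which tests
  the current label; \<open>Tst\<close> subtracts the square of the tested register too. Coefficient
  0 at register 0 lets \<open>q'\<close> overwrite the label.\<close>

fun trans_letter :: "trans \<Rightarrow> letter" where
  "trans_letter (q, Asg i a j c, q') = Letter
    (\<lambda>k. if k = 0 then 0 else if k = Suc i then a else 1)
    (\<lambda>k. if k = Suc i then Suc j else k)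
    (\<lambda>k. if k = 0 then of_nat q' else if k = Suc i then c else 0)
    (- (of_nat q)\<^sup>2) (\<lambda>k. if k = 0 then 2 * of_nat q else 0) (\<lambda>k. if k = 0 then - 1 else 0) (- 1) (- 1)"
| "trans_letter (q, Tst i, q') = Letter
    (\<lambda>k. if k = 0 then 0 else 1) (\<lambda>k. k) (\<lambda>k. if k = 0 then of_nat q' else 0)
    (- (of_nat q)\<^sup>2) (\<lambda>k. if k = 0 then 2 * of_nat q else 0)
    (\<lambda>k. if k = 0 then - 1 else if k = Suc i then - 1 else 0) (- 1) (- 1)"

text \<open>As all coefficients are 0 and nothing is tested, a further occurrence inside a word
  merely restarts the run, which is harmless.\<close>

definition init_letter :: "nat list \<Rightarrow> letter" where
  "init_letter xs = Letter (\<lambda>_. 0) (\<lambda>k. k)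
    (\<lambda>k. if 0 < k \<and> k \<le> length xs then of_nat (xs ! (k - 1)) else 0)
    0 (\<lambda>_. 0) (\<lambda>_. 0) 0 (- 1)"

text \<open>The registers are cleared because they may hold negative values, which would spoil row
  0. The final entry 0 does the same for column \<open>2 * N + 3\<close>.\<close>

definition final_letter :: "nat \<Rightarrow> letter" where
  "final_letter h = Letter (\<lambda>_. 0) (\<lambda>k. k) (\<lambda>_. 0)
    (- (of_nat h)\<^sup>2) (\<lambda>k. if k = 0 then 2 * of_nat h else 0) (\<lambda>k. if k = 0 then - 1 else 0) (- 1) 0"

lemma init_neq_final: "init_letter xs \<noteq> final_letter h"
  by (simp add: init_letter_def final_letter_def)

definition input_store :: "nat list \<Rightarrow> store" where
  "input_store xs i = (if i < length xs then of_nat (xs ! i) else 0)"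

fun cmd_below :: "nat \<Rightarrow> cmd \<Rightarrow> bool" where
  "cmd_below n (Asg i a j c) \<longleftrightarrow> i < n \<and> j < n"
| "cmd_below n (Tst i) \<longleftrightarrow> i < n"

lemma cmd_below_mono: "cmd_below m c \<Longrightarrow> m \<le> n \<Longrightarrow> cmd_below n c"
  by (cases c) auto

lemma cmd_below_exists: "\<exists>n\<ge>m. \<forall>(q, c, q')\<in>set T. cmd_below n c"
proof (induction T)
  case (Cons t T)
  obtain q c q' where t: "t = (q, c, q')" by (cases t)
  obtain n where n: "n \<ge> m" "\<forall>(q, c, q')\<in>set T. cmd_below n c" using Cons.IH by blast
  have "\<exists>k. cmd_below k c"
  proof (cases c)
    case (Asg i a j d)
    then show ?thesis by (intro exI[of _ "Suc (max i j)"]) auto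
  next
    case (Tst i)
    then show ?thesis by (intro exI[of _ "Suc i"]) auto
  qed
  then obtain k where "cmd_below k c" ..
  then show ?case using n t
    by (intro exI[of _ "max k n"]) (auto intro: cmd_below_mono[OF _ max.cobounded1] cmd_below_mono[OF _ max.cobounded2])
qed auto

lemma update_init: "update (init_letter xs) S = config (0, input_store xs)"
  by (auto simp: update_def init_letter_def config_def input_store_def fun_eq_iff split: nat.split)

lemma penalty_init: "penalty N (init_letter xs) S = 0"
  by (simp add: penalty_def init_letter_def)

lemma update_final: "update (final_letter h) S = (\<lambda>_. 0)"
  by (auto simp: update_def final_letter_def)

lemma label_test_polynomial:
  fixes S :: "nat \<Rightarrow> rat"
  assumes "0 < N"
  shows "- v\<^sup>2 + (\<Sum>k<N. (if k = 0 then 2 * v else 0) * S k + (if k = 0 then - 1 else 0) * (S k)\<^sup>2) =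
    - (S 0 - v)\<^sup>2"
proof -
  have "(\<Sum>k<N. (if k = 0 then 2 * v else 0) * S k + (if k = 0 then - 1 else 0) * (S k)\<^sup>2) =
      (\<Sum>k<N. if k = 0 then 2 * v * S 0 - (S 0)\<^sup>2 else 0)"
    by (intro sum.cong) auto
  then show ?thesis using assms by (simp add: power2_eq_square algebra_simps)
qed

lemma penalty_final: "0 < N \<Longrightarrow> penalty N (final_letter h) S = - (S 0 - of_nat h)\<^sup>2"
  using label_test_polynomial[of N "of_nat h" S] by (simp add: penalty_def final_letter_def)

lemma penalty_Asg:
  "0 < N \<Longrightarrow> penalty N (trans_letter (q, Asg i a j c, q')) S = - (S 0 - of_nat q)\<^sup>2"
  using label_test_polynomial[of N "of_nat q" S] by (simp add: penalty_def)

lemma penalty_Tst: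
  assumes "Suc i < N"
  shows "penalty N (trans_letter (q, Tst i, q')) S = - (S 0 - of_nat q)\<^sup>2 - (S (Suc i))\<^sup>2"
proof -
  let ?v = "of_nat q :: rat"
  have "(\<Sum>k<N. (if k = 0 then 2 * ?v else 0) * S k +
        (if k = 0 then - 1 else if k = Suc i then - 1 else 0) * (S k)\<^sup>2) =
      (\<Sum>k<N. ((if k = 0 then 2 * ?v else 0) * S k + (if k = 0 then - 1 else 0) * (S k)\<^sup>2) +
        (if k = Suc i then - (S k)\<^sup>2 else 0))"
    by (intro sum.cong) auto
  also have "\<dots> = (\<Sum>k<N. (if k = 0 then 2 * ?v else 0) * S k + (if k = 0 then - 1 else 0) * (S k)\<^sup>2) -
      (S (Suc i))\<^sup>2"
    unfolding sum.distrib[of _ "\<lambda>k. if k = Suc i then - (S k)\<^sup>2 else 0"] using assms by simp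
  finally show ?thesis
    using label_test_polynomial[of N ?v S] assms by (simp add: penalty_def)
qed

lemma update_Asg: "update (trans_letter (q, Asg i a j c, q')) (config (k, s)) = config (q', s(i := a * s j + c))"
  by (auto simp: update_def config_def fun_eq_iff split: nat.split)

lemma update_Tst: "update (trans_letter (q, Tst i, q')) (config (k, s)) = config (q', s)"
  by (auto simp: update_def config_def fun_eq_iff split: nat.split)

lemma penalty_trans_nonpos:
  assumes "cmd_below n c"
  shows "penalty (Suc n) (trans_letter (q, c, q')) S \<le> 0"
  using assms
  by (cases c) (auto simp: penalty_Asg penalty_Tst simp del: trans_letter.simps intro: order_trans[of _ 0])

lemma trans_letter_step:
  assumes "cmd_below n c" "((q, s), (q', s')) \<in> step {(q, c, q')}"
  shows "penalty (Suc n) (trans_letter (q, c, q')) (config (q, s)) = 0"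
    and "update (trans_letter (q, c, q')) (config (q, s)) = config (q', s')"
  using assms
  by (cases c; simp add: step_def penalty_Asg penalty_Tst update_Asg update_Tst del: trans_letter.simps; simp add: config_def)+

text \<open>The penalty is minus a sum of squares, of the label difference and for
  \<open>Tst\<close> of the tested register. If it vanishes, so does each square, and the letter
  performs a genuine step.\<close>

lemma step_of_penalty_zero:
  assumes "cmd_below n c" "penalty (Suc n) (trans_letter (q, c, q')) (config (k, s)) = 0"
  obtains s' where "((k, s), (q', s')) \<in> step {(q, c, q')}"
    "update (trans_letter (q, c, q')) (config (k, s)) = config (q', s')"
proof (cases c)
  case (Asg i a j d)
  then have "k = q"
    using assms by (simp add: penalty_Asg config_def del: trans_letter.simps)
  then show ?thesis
    using that[of "s(i := a * s j + d)"] Asg by (simp add: step_def update_Asg del: trans_letter.simps)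
next
  case (Tst i)
  then have "- (of_nat k - of_nat q)\<^sup>2 = (s i)\<^sup>2"
    using assms by (simp add: penalty_Tst config_def del: trans_letter.simps)
  then have "(of_nat k - of_nat q)\<^sup>2 + (s i)\<^sup>2 = 0" by linarith
  then have "k = q" "s i = 0" by (auto simp: sum_power2_eq_zero_iff)
  then show ?thesis
    using that[of s] Tst by (simp add: step_def update_Tst del: trans_letter.simps)
qed

lemma first_entry_trans [simp]: "first_entry (trans_letter t) = - 1"
  and last_entry_trans [simp]: "last_entry (trans_letter t) = - 1"
  by (cases t rule: trans_letter.cases; simp)+

lemma trans_neq_final: "trans_letter t \<noteq> final_letter h"
proof
  assume "trans_letter t = final_letter h"
  then have "last_entry (trans_letter t) = last_entry (final_letter h)" by (rule arg_cong)
  then show False by (simp add: final_letter_def)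
qed

section \<open>Words of letters and runs of the transition system\<close>

definition letters :: "trans list \<Rightarrow> nat \<Rightarrow> nat list \<Rightarrow> letter list" where
  "letters T h xs = init_letter xs # final_letter h # map trans_letter T"

lemma wf_letters:
  assumes "\<forall>(q, c, q')\<in>set T. cmd_below n c" "a \<in> set (letters T h xs)"
  shows "wf_letter (Suc n) a"
proof -
  have "wf_letter (Suc n) (trans_letter (q, c, q'))" if "cmd_below n c" for q c q'
    using that by (cases c) (auto simp: wf_letter_def)
  then show ?thesis
    using assms by (auto simp: letters_def init_letter_def final_letter_def wf_letter_def)
qed

lemma penalty_letters_nonpos:
  assumes "\<forall>(q, c, q')\<in>set T. cmd_below n c" "a \<in> set (letters T h xs)"
  shows "penalty (Suc n) a S \<le> 0"
  using assms penalty_trans_nonpos by (fastforce simp: letters_def penalty_init penalty_final)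

lemma run_penalty_nonpos:
  assumes "\<forall>(q, c, q')\<in>set T. cmd_below n c" "set ws \<subseteq> set (letters T h xs)"
  shows "snd (run (Suc n) ws) \<le> 0"
  using assms(2)
proof (induction ws rule: rev_induct)
  case (snoc a ws)
  then show ?case
    using penalty_letters_nonpos[OF assms(1), of a h xs] by (simp add: add_nonpos_nonpos)
qed simp

text \<open>As no penalty is positive, total 0 forces each one to be 0. The registers after a
  \<open>final_letter\<close> may belong to no reachable configuration, but passing it without
  penalty already shows that \<open>h\<close> was reached; hence the first alternative.\<close>

lemma run_reaches:
  assumes T: "\<forall>(q, c, q')\<in>set T. cmd_below n c" and "set ws \<subseteq> set (letters T h xs)"
    and "snd (run (Suc n) (init_letter xs # ws)) = 0"
  defines "reach \<equiv> \<lambda>c. ((0, input_store xs), c) \<in> (step (set T))\<^sup>*"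
  shows "(\<exists>s. reach (h, s)) \<or> (\<exists>c. reach c \<and> fst (run (Suc n) (init_letter xs # ws)) = config c) \<and>
    last (init_letter xs # ws) \<noteq> final_letter h"
  using assms(2,3)
proof (induction ws rule: rev_induct)
  case Nil
  have "run (Suc n) [init_letter xs] = (config (0, input_store xs), 0)"
    using run_snoc[of "Suc n" "[]" "init_letter xs"] by (simp add: update_init penalty_init)
  then show ?case by (auto simp: reach_def init_neq_final)
next
  case (snoc a ws)
  let ?w = "init_letter xs # ws"
  have run: "run (Suc n) (init_letter xs # ws @ [a]) =
      (update a (fst (run (Suc n) ?w)), snd (run (Suc n) ?w) + penalty (Suc n) a (fst (run (Suc n) ?w)))"
    using run_snoc[of "Suc n" ?w a] by simp
  have a: "a \<in> set (letters T h xs)" using snoc.prems by simp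
  have "set ?w \<subseteq> set (letters T h xs)" using snoc.prems(1) by (simp add: letters_def)
  from run_penalty_nonpos[OF T this] penalty_letters_nonpos[OF T a, of "fst (run (Suc n) ?w)"]
  have zero: "snd (run (Suc n) ?w) = 0" "penalty (Suc n) a (fst (run (Suc n) ?w)) = 0"
    using snoc.prems(2) unfolding run by auto
  from snoc.IH[OF _ zero(1)] snoc.prems(1) consider "\<exists>s. reach (h, s)"
    | q s where "reach (q, s)" "fst (run (Suc n) ?w) = config (q, s)" by auto
  then show ?case
  proof cases
    case 1
    then show ?thesis by blast
  next
    case 2
    consider "a = init_letter xs" | "a = final_letter h" | k c q' where "(k, c, q') \<in> set T" "a = trans_letter (k, c, q')"
      using a by (auto simp: letters_def)
    then show ?thesis
    proof cases
      case 1
      then show ?thesis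
        unfolding run by (auto simp: update_init reach_def init_neq_final)
    next
      case 2
      then have "q = h"
        using zero(2) \<open>fst (run (Suc n) ?w) = config (q, s)\<close> by (simp add: penalty_final config_def)
      then show ?thesis using \<open>reach (q, s)\<close> by blast
    next
      case 3
      have "cmd_below n c" using T 3 by auto
      from step_of_penalty_zero[OF this, of k q' q s] zero(2) 2 3(2)
      obtain s' where s': "((q, s), (q', s')) \<in> step {(k, c, q')}" "update a (config (q, s)) = config (q', s')"
        by auto
      have "reach (q', s')"
        using \<open>reach (q, s)\<close> s'(1) 3(1) unfolding reach_def
        by (auto simp: step_def intro: rtrancl_into_rtrancl)
      moreover have "a \<noteq> final_letter h"
        using 3(2) by (simp add: trans_neq_final)
      ultimately show ?thesis using s'(2) 2 unfolding run by auto
    qed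
  qed
qed

lemma run_complete:
  assumes T: "\<forall>(q, c, q')\<in>set T. cmd_below n c"
    and "((0, input_store xs), (q, s)) \<in> (step (set T))\<^sup>*"
  shows "\<exists>ws. set ws \<subseteq> set (letters T h xs) \<and> run (Suc n) (init_letter xs # ws) = (config (q, s), 0)"
  using assms(2)
proof (induction rule: rtrancl_induct2)
  case refl
  have "run (Suc n) [init_letter xs] = (config (0, input_store xs), 0)"
    using run_snoc[of "Suc n" "[]" "init_letter xs"] by (simp add: update_init penalty_init)
  then show ?case by (intro exI[of _ "[]"]) simp
next
  case (step q s q' s')
  then obtain c where c: "(q, c, q') \<in> set T" "((q, s), (q', s')) \<in> step {(q, c, q')}"
    by (auto simp: step_def)
  have below: "cmd_below n c" using T c(1) by auto
  from step.IH obtain ws where ws: "set ws \<subseteq> set (letters T h xs)"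
    "run (Suc n) (init_letter xs # ws) = (config (q, s), 0)" by blast
  have "run (Suc n) (init_letter xs # ws @ [trans_letter (q, c, q')]) = (config (q', s'), 0)"
    using run_snoc[of "Suc n" "init_letter xs # ws" "trans_letter (q, c, q')"] ws(2)
      trans_letter_step[OF below c(2)] by simp
  then show ?case using ws(1) c(1)
    by (intro exI[of _ "ws @ [trans_letter (q, c, q')]"]) (auto simp: letters_def)
qed

text \<open>Three entries decide the forward direction: two fix the first and the last letter, and
  the accumulator in row 0 shows that the penalty is 0. Conversely, a run framed by these two
  letters gives a product that is nonnegative in every row.\<close>

theorem nonneg_iff_reaches:
  assumes T: "\<forall>(q, c, q')\<in>set T. cmd_below n c"
  shows "(\<exists>B\<in>gen_semigroup (map (letter_mat (Suc n)) (letters T h xs)). nonneg_mat B) \<longleftrightarrow>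
    (\<exists>s. ((0, input_store xs), (h, s)) \<in> (step (set T))\<^sup>*)"
proof
  assume "\<exists>B\<in>gen_semigroup (map (letter_mat (Suc n)) (letters T h xs)). nonneg_mat B"
  then obtain ws where ws: "ws \<noteq> []" "set ws \<subseteq> set (letters T h xs)" "nonneg_mat (word_prod (Suc n) ws)"
    unfolding gen_semigroup_letters by blast
  have wf: "\<forall>a\<in>set ws. wf_letter (Suc n) a" using wf_letters[OF T] ws(2) by blast
  have nonneg: "word_prod (Suc n) ws $$ (i, j) \<ge> 0" if "i < 2 * Suc n + 4" "j < 2 * Suc n + 4" for i j
    using ws(3) that carrier_matD[OF word_prod_carrier[of "Suc n" ws]] by (simp add: nonneg_mat_def)
  have "first_entry (hd ws) \<ge> 0"
    using nonneg[of "2 * Suc n + 2" 0] word_prod_first[OF ws(1), of "Suc n"] by simp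
  moreover have "hd ws \<in> set (letters T h xs)" using ws(1,2) by auto
  ultimately have hd: "hd ws = init_letter xs"
    by (auto simp: letters_def final_letter_def)
  have "last_entry (last ws) \<ge> 0"
    using nonneg[of "2 * Suc n + 1" "2 * Suc n + 3"] word_prod_last[OF wf ws(1)] by simp
  moreover have "last ws \<in> set (letters T h xs)" using ws(1,2) by auto
  ultimately have last: "last ws = final_letter h"
    by (auto simp: letters_def init_letter_def)
  have "snd (run (Suc n) ws) \<ge> 0"
    using nonneg[of 0 "2 * Suc n + 1"] word_prod_row_0[OF wf] by (simp add: config_row_def)
  then have "snd (run (Suc n) ws) = 0" using run_penalty_nonpos[OF T ws(2)] by simp
  moreover obtain us where us: "ws = init_letter xs # us" using hd ws(1) by (cases ws) auto
  ultimately show "\<exists>s. ((0, input_store xs), (h, s)) \<in> (step (set T))\<^sup>*"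
    using run_reaches[OF T, of us h xs] ws(2) last by auto
next
  assume "\<exists>s. ((0, input_store xs), (h, s)) \<in> (step (set T))\<^sup>*"
  then obtain s us where us: "set us \<subseteq> set (letters T h xs)"
    "run (Suc n) (init_letter xs # us) = (config (h, s), 0)"
    using run_complete[OF T] by blast
  let ?v = "init_letter xs # us"
  let ?w = "init_letter xs # us @ [final_letter h]"
  have set: "set ?v \<subseteq> set (letters T h xs)" "set ?w \<subseteq> set (letters T h xs)"
    using us(1) by (auto simp: letters_def)
  then have wf: "\<forall>a\<in>set ?v. wf_letter (Suc n) a" "\<forall>a\<in>set ?w. wf_letter (Suc n) a"
    using wf_letters[OF T] by blast+
  have run: "run (Suc n) ?w = (\<lambda>_. 0, 0)"
    using run_snoc[of "Suc n" ?v "final_letter h"] us(2)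
    by (simp add: update_final penalty_final config_def)
  have "word_prod (Suc n) ?w $$ (i, j) \<ge> 0" if ij: "i < 2 * Suc n + 4" "j < 2 * Suc n + 4" for i j
  proof -
    \<comment> \<open>Row 0 is a configuration with cleared registers and accumulator 0, row
      \<open>2 * Suc n + 1\<close> a unit vector, and the first letter annihilates all other
      rows.\<close>
    consider "i = 0" | "i = 2 * Suc n + 1" | "0 < i" "i \<noteq> 2 * Suc n + 1" by blast
    then show ?thesis
    proof cases
      case 1
      have "word_prod (Suc n) ?w $$ (0, 2 * Suc n + 3) =
          word_prod (Suc n) ?v $$ (0, 2 * Suc n + 1) * last_entry (final_letter h)"
        using mult_letter_mat(6)[OF word_prod_carrier, of 0 "Suc n" ?v "final_letter h"]
          word_prod_snoc[of "Suc n" ?v "final_letter h"] by simp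
      then have "word_prod (Suc n) ?w $$ (0, 2 * Suc n + 3) = 0" by (simp add: final_letter_def)
      with word_prod_row_0[OF wf(2)] show ?thesis
        unfolding 1 run config_row_def by (cases rule: index_cases[OF ij(2)]) auto
    next
      case 2
      have "word_prod (Suc n) ?w $$ (2 * Suc n + 1, 2 * Suc n + 3) = 0"
        using word_prod_last[OF wf(2)] by (simp add: final_letter_def)
      moreover have "j \<le> 2 * Suc n + 2 \<or> j = 2 * Suc n + 3" using ij(2) by linarith
      ultimately show ?thesis
        using word_prod_row_acc[OF wf(2), of j] unfolding 2 by auto
    next
      case 3
      then show ?thesis
        using word_prod_zero_rows[of "init_letter xs" i "Suc n" j "us @ [final_letter h]"] ij
        by (simp add: init_letter_def)
    qed
  qed
  then have "nonneg_mat (word_prod (Suc n) ?w)"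
    using carrier_matD[OF word_prod_carrier[of "Suc n" ?w]] by (simp add: nonneg_mat_def)
  then show "\<exists>B\<in>gen_semigroup (map (letter_mat (Suc n)) (letters T h xs)). nonneg_mat B"
    unfolding gen_semigroup_letters using set(2) by blast
qed

section \<open>Diagonalisation: an instance run on the codes of its own parts\<close>

section \<open>Self-reference through the instance code\<close>

lemma list_all2_eval_cons:
  assumes "eval base xs (list_encode as)" "list_all2 (\<lambda>g v. eval g xs v) gs vs"
  shows "eval (foldr (\<lambda>g. rf_cons (rf_rat g)) gs base) xs
    (list_encode (map (\<lambda>v. encode_rat (of_nat v)) vs @ as))"
  using assms(2,1) by induction (auto intro!: eval_cons eval_rat simp del: list_encode.simps)

text \<open>The input enters \<open>init_letter\<close> only through its constants, and these stand
  in row 0. The code of the other rows can thus be part of the input itself.\<close>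

lemma letter_mat_init_rows:
  assumes "0 < i" "i < 2 * N + 4" "j < 2 * N + 4"
  shows "letter_mat N (init_letter xs) $$ (i, j) = letter_mat N (init_letter ys) $$ (i, j)"
  using assms
  by (auto simp: letter_mat_def init_letter_def Let_def column_def cong: if_cong)

lemma init_rows_cong:
  "map (\<lambda>i. f (map g (map (\<lambda>j. letter_mat N (init_letter xs) $$ (i, j)) [0..<2 * N + 4]))) [1..<2 * N + 4] =
   map (\<lambda>i. f (map g (map (\<lambda>j. letter_mat N (init_letter ys) $$ (i, j)) [0..<2 * N + 4]))) [1..<2 * N + 4]"
proof (rule map_cong[OF refl])
  fix i assume i: "i \<in> set [1..<2 * N + 4]"
  have "map (\<lambda>j. letter_mat N (init_letter xs) $$ (i, j)) [0..<2 * N + 4] =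
      map (\<lambda>j. letter_mat N (init_letter ys) $$ (i, j)) [0..<2 * N + 4]"
    by (rule map_cong[OF refl], rule letter_mat_init_rows) (use i in auto)
  then show "f (map g (map (\<lambda>j. letter_mat N (init_letter xs) $$ (i, j)) [0..<2 * N + 4])) =
      f (map g (map (\<lambda>j. letter_mat N (init_letter ys) $$ (i, j)) [0..<2 * N + 4]))"
    by (simp only:)
qed

lemma const_init:
  "const (init_letter xs) k = (if 0 < k \<and> k \<le> length xs then of_nat (xs ! (k - 1)) else 0)"
  by (simp add: init_letter_def)

lemma letter_mat_init_row_0:
  assumes "j < 2 * N + 4"
  shows "letter_mat N (init_letter xs) $$ (0, j) =
    (if j = 0 then 1 else if j \<le> 2 * N then
      (if odd j then const (init_letter xs) (j div 2) else (const (init_letter xs) (j div 2 - 1))\<^sup>2) else 0)"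
  using assms by (auto simp: letter_mat_def column_def Let_def init_letter_def)

text \<open>After the constant come the label 0 and its square, then each input with its square: 11
  entries, and \<open>2 * N - 7\<close> zeros complete the \<open>2 * N + 4\<close>. Label and four
  inputs occupy five registers, hence \<open>N \<ge> 5\<close>.\<close>

lemma row_0_list:
  assumes "N \<ge> 5"
  shows "map (\<lambda>j. letter_mat N (init_letter [a, b, c, d]) $$ (0, j)) [0..<2 * N + 4] =
    map of_nat [1, 0, 0, a, a * a, b, b * b, c, c * c, d, d * d] @ replicate (2 * N - 7) 0"
proof (rule nth_equalityI)
  show "length (map (\<lambda>j. letter_mat N (init_letter [a, b, c, d]) $$ (0, j)) [0..<2 * N + 4]) =
    length (map of_nat [1, 0, 0, a, a * a, b, b * b, c, c * c, d, d * d] @ replicate (2 * N - 7) (0 :: rat))"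
    using assms by simp
next
  fix j assume "j < length (map (\<lambda>j. letter_mat N (init_letter [a, b, c, d]) $$ (0, j)) [0..<2 * N + 4])"
  then have j: "j < 2 * N + 4" by simp
  show "map (\<lambda>j. letter_mat N (init_letter [a, b, c, d]) $$ (0, j)) [0..<2 * N + 4] ! j =
     (map of_nat [1, 0, 0, a, a * a, b, b * b, c, c * c, d, d * d] @ replicate (2 * N - 7) 0) ! j"
  proof (cases "j < 11")
    case True
    then have "j = 0 \<or> j = 1 \<or> j = 2 \<or> j = 3 \<or> j = 4 \<or> j = 5 \<or> j = 6 \<or> j = 7 \<or> j = 8 \<or> j = 9 \<or> j = 10"
      by presburger
    then show ?thesis
      using j assms
      by (elim disjE)
        (simp_all add: letter_mat_init_row_0 const_init power2_eq_square nth_append)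
  next
    case False
    have "j div 2 \<ge> 5" using False div_le_mono[of 11 j 2] by simp
    moreover have "j div 2 - 1 \<ge> 5" if "even j"
      using that False by (auto elim!: evenE)
    ultimately have "letter_mat N (init_letter [a, b, c, d]) $$ (0, j) = 0"
      using False by (subst letter_mat_init_row_0[OF j]) (auto simp: const_init)
    then show ?thesis using j False by (simp add: nth_append)
  qed
qed

text \<open>Each input is used in two ways, as a number loaded into row 0 and as the dimension or
  the code of a part of the instance. This double use is the self-reference.\<close>

definition rf_code :: recf where
  "rf_code = rf_pair (Proj 0) (Comp Succ [rf_pair
     (rf_pair (Proj 0) (rf_pair (Proj 0) (Comp Succ [rf_pair
       (foldr (\<lambda>g. rf_cons (rf_rat g))
         [rf_const 1, rf_const 0, rf_const 0,
          Proj 0, Comp rf_mult [Proj 0, Proj 0], Proj 1, Comp rf_mult [Proj 1, Proj 1],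
          Proj 2, Comp rf_mult [Proj 2, Proj 2], Proj 3, Comp rf_mult [Proj 3, Proj 3]] (Proj 1))
       (Proj 2)])))
     (Proj 3)])"

text \<open>The four inputs are the dimension and the codes of the constant parts of an instance: the zeros
  at the end of the first row of the first matrix, the other rows of that matrix, and the other matrices.\<close>

lemma eval_rf_code:
  assumes "N \<ge> 5"
  shows "\<exists>r R. \<forall>L Ms. L = list_encode (map encode_mat Ms) \<longrightarrow> eval rf_code [2 * N + 4, r, R, L]
    (encode_instance (2 * N + 4, letter_mat N (init_letter [2 * N + 4, r, R, L]) # Ms))"
proof -
  let ?d = "2 * N + 4"
  let ?row = "\<lambda>xs i. list_encode (map encode_rat (map (\<lambda>j. letter_mat N (init_letter xs) $$ (i, j)) [0..<?d]))"
  define r where "r = list_encode (replicate (2 * N - 7) (encode_rat 0))"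
  \<comment> \<open>The rows below the first are the same for every input list. Taking the empty
    list avoids circularity, since \<open>R\<close> itself becomes one of the inputs.\<close>
  define R where "R = list_encode (map (?row []) [1..<?d])"
  show ?thesis
  proof (intro exI allI impI)
    fix L Ms assume L: "L = list_encode (map encode_mat Ms)"
    let ?xs = "[?d, r, R, L]"
    have R: "R = list_encode (map (?row ?xs) [1..<?d])"
      by (rule trans[OF R_def], rule arg_cong, rule init_rows_cong)
    have upt: "[0..<?d] = 0 # [1..<?d]"
      unfolding One_nat_def by (rule upt_conv_Cons) simp
    have "encode_mat (letter_mat N (init_letter ?xs)) =
        prod_encode (?d, prod_encode (?d, list_encode (map (?row ?xs) [0..<?d])))"
      by (simp only: encode_mat_def mat_to_list_def letter_mat_dim map_map comp_def)
    also have "list_encode (map (?row ?xs) [0..<?d]) =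
        Suc (prod_encode (?row ?xs 0, list_encode (map (?row ?xs) [1..<?d])))"
      by (simp only: upt list.map list_encode.simps)
    also have "list_encode (map (?row ?xs) [1..<?d]) = R"
      by (rule R[symmetric])
    finally have mat: "encode_mat (letter_mat N (init_letter ?xs)) =
        prod_encode (?d, prod_encode (?d, Suc (prod_encode (?row ?xs 0, R))))" .
    have sq: "eval (Comp rf_mult [Proj i, Proj i]) ?xs (?xs ! i * ?xs ! i)" if "i < 4" for i
      using that by (intro eval_Comp2[OF eval_Proj eval_Proj eval_mult]) auto
    have proj: "eval (Proj i) ?xs (?xs ! i)" if "i < 4" for i
      using that by (intro eval_Proj) auto
    have row: "?row ?xs 0 = list_encode (map (\<lambda>v. encode_rat (of_nat v))
        [1, 0, 0, ?d, ?d * ?d, r, r * r, R, R * R, L, L * L] @ replicate (2 * N - 7) (encode_rat 0))"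
      unfolding row_0_list[OF assms] by (simp del: list_encode.simps)
    have "eval (foldr (\<lambda>g. rf_cons (rf_rat g))
         [rf_const 1, rf_const 0, rf_const 0,
          Proj 0, Comp rf_mult [Proj 0, Proj 0], Proj 1, Comp rf_mult [Proj 1, Proj 1],
          Proj 2, Comp rf_mult [Proj 2, Proj 2], Proj 3, Comp rf_mult [Proj 3, Proj 3]] (Proj 1)) ?xs (?row ?xs 0)"
      unfolding row
    proof (rule list_all2_eval_cons)
      show "eval (Proj 1) ?xs (list_encode (replicate (2 * N - 7) (encode_rat 0)))"
        using proj[of 1] by (simp add: r_def)
    qed (use sq[of 0] sq[of 1] sq[of 2] sq[of 3] proj[of 0] proj[of 1] proj[of 2] proj[of 3]
        eval_const[of 0 ?xs] eval_const[of 1 ?xs] in auto)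
    then have "eval rf_code ?xs (prod_encode (?d, Suc (prod_encode
        (encode_mat (letter_mat N (init_letter ?xs)), L))))"
      unfolding rf_code_def mat
      by (intro eval_pair eval_Comp1[OF _ eval_Succ])
        (use proj[of 0] proj[of 2] proj[of 3] in auto)
    then show "eval rf_code ?xs (encode_instance (?d, letter_mat N (init_letter ?xs) # Ms))"
      by (simp add: encode_instance_def L)
  qed
qed

text \<open>A zero test on the output register \<open>k\<close> is appended to the program for
  \<open>f\<close>, so that its exit label is reached exactly when the value is 0. The transitions
  do not depend on \<open>xs\<close>.\<close>

lemma reaches_iff_eval_zero:
  "\<exists>T h. \<forall>xs. length xs = k \<longrightarrow>
     ((\<exists>s. ((0, input_store xs), (h, s)) \<in> (step (set T))\<^sup>*) \<longleftrightarrow> eval f xs 0)"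
proof -
  have "set [0..<k] \<subseteq> {..<Suc k}" "k < Suc k" by auto
  from recf_computable[OF this] obtain p where p: "computes p f [0..<k] k (Suc k)" ..
  let ?p = "Seq p (Cmd (Tst k))"
  have "(\<exists>s. ((0, input_store xs), (plen ?p, s)) \<in> (step (set (flat ?p 0)))\<^sup>*) \<longleftrightarrow> eval f xs 0"
    if "length xs = k" for xs
  proof -
    have "map (input_store xs) [0..<k] = map of_nat xs"
      using that by (auto intro: nth_equalityI simp: input_store_def)
    note sound = computes_sound[OF p this] and complete = computes_complete[OF p this]
    have "(\<exists>s. ((0, input_store xs), (plen ?p, s)) \<in> (step (set (flat ?p 0)))\<^sup>*) \<longleftrightarrow>
        (\<exists>s. (input_store xs, s) \<in> sem ?p)"
      using flat_sound[of 0 "input_store xs" ?p] flat_complete[of "input_store xs" _ ?p 0]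
      unfolding add_0 by blast
    also have "\<dots> \<longleftrightarrow> (\<exists>s. (input_store xs, s) \<in> sem p \<and> s k = 0)" by auto
    also have "\<dots> \<longleftrightarrow> eval f xs 0"
      by (metis sound complete of_nat_0 of_nat_eq_0_iff)
    finally show ?thesis .
  qed
  then show ?thesis by blast
qed

theorem mainTheorem10:
  shows "\<not> decidable_problem encode_instance admissible_instance semigroup_has_nonneg"
proof
  assume "decidable_problem encode_instance admissible_instance semigroup_has_nonneg"
  then obtain f where f: "\<And>x. admissible_instance x \<Longrightarrow>
      eval f [encode_instance x] (if semigroup_has_nonneg x then 1 else 0)"
    unfolding decidable_problem_def by blast
  let ?g = "Comp f [rf_code]"
  obtain T h where T: "\<And>xs. length xs = 4 \<Longrightarrow>
      (\<exists>s. ((0, input_store xs), (h, s)) \<in> (step (set T))\<^sup>*) \<longleftrightarrow> eval ?g xs 0"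
    using reaches_iff_eval_zero[of 4 ?g] by blast
  \<comment> \<open>The bound 4 makes room for the four inputs next to the label register.\<close>
  obtain n where n: "n \<ge> 4" "\<forall>(q, c, q')\<in>set T. cmd_below n c"
    using cmd_below_exists[of 4 T] by blast
  let ?N = "Suc n"
  let ?Ms = "map (letter_mat ?N) (final_letter h # map trans_letter T)"
  have "?N \<ge> 5" using n(1) by simp
  from eval_rf_code[OF this] obtain r R where code: "\<And>L Ms. L = list_encode (map encode_mat Ms) \<Longrightarrow>
      eval rf_code [2 * ?N + 4, r, R, L]
        (encode_instance (2 * ?N + 4, letter_mat ?N (init_letter [2 * ?N + 4, r, R, L]) # Ms))"
    by blast
  \<comment> \<open>No component refers to \<open>xs\<close>: the input occurs only in row 0 of the
    first matrix, which is left out here and rebuilt by \<open>rf_code\<close>.\<close>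
  define xs where "xs = [2 * ?N + 4, r, R, list_encode (map encode_mat ?Ms)]"
  define inst where "inst = (2 * ?N + 4, letter_mat ?N (init_letter xs) # ?Ms)"
  have "snd inst = map (letter_mat ?N) (letters T h xs)" by (simp add: inst_def letters_def)
  then have halts: "semigroup_has_nonneg inst \<longleftrightarrow> eval ?g xs 0"
    using nonneg_iff_reaches[OF n(2), of h xs] T[of xs]
    by (simp add: semigroup_has_nonneg_def xs_def del: T)
  have "admissible_instance inst"
    by (auto simp: admissible_instance_def inst_def)
  \<comment> \<open>On \<open>xs\<close> the function \<open>?g\<close> returns the verdict of the
    decider on \<open>inst\<close>, whereas by \<open>halts\<close> the instance is positive exactly
    if this verdict is 0.\<close>
  from f[OF this] have "eval ?g xs (if semigroup_has_nonneg inst then 1 else 0)"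
    using code[OF refl, of ?Ms] unfolding xs_def[symmetric] inst_def[symmetric] by (rule eval_Comp1[rotated])
  then show False
    using halts eval_deterministic[of ?g xs 1 0] by (auto split: if_splits)
qed

end
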